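(* Let $R$ be a unital topological ring. Suppose that $\pi\colon\Lambda\to\Gamma$ is a continuous $R$-bundle, where $\Gamma$ is an étale, globally Hausdorff, locally $R$-normal semigroupoid whose multiplication map $\Gamma^{(2)}\to\Gamma$ is proper. Then the compact-open topology makes $\mathcal{A}(\pi)$ into a topological algebra.
   Context: A continuous map is proper if preimages of compact sets are compact. The compact-open topology on a set $\mathcal{A}$ of functions $X\to Y$ is generated by the sets $[K,V]=\{f\in\mathcal{A}:f(K)\subseteq V\}$, $K\subseteq X$ compact, $V\subseteq Y$ open. Topological algebra means addition, multiplication and left and right scalar multiplication by $R$ are continuous. A space has a property "locally" if every point has a neighbourhood basis (neighbourhoods not necessarily open) of subsets having that property in the subspace topology. A space $X$ is $R$-normal if for any disjoint closed $A,B\subseteq X$ there is a continuous $f\colon X\to R$ with $f=0$ on $A$, $f=1$ on $B$. A semigroupoid $\Lambda$ is a directed graph with vertex set $\Lambda^{(0)}$, source and range maps $\mathfrak{s},\mathfrak{r}\colon\Lambda\to\Lambda^{(0)}$, and an associative product $\Lambda^{(2)}=\{(a,b):\mathfrak{s}(a)=\mathfrak{r}(b)\}\to\Lambda$ with $\mathfrak{s}(ab)=\mathfrak{s}(b)$, $\mathfrak{r}(ab)=\mathfrak{r}(a)$. A homomorphism $\phi$ satisfies: $(a,b)$ composable implies $(\phi(a),\phi(b))$ composable and $\phi(ab)=\phi(a)\phi(b)$; it is rigid if conversely $(\phi(a),\phi(b))$ composable implies $(a,b)$ composable. Topological semigroupoid: $\mathfrak{s},\mathfrak{r}$ and product continuous.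 Étale: $\mathfrak{s},\mathfrak{r}$ are local homeomorphisms and $\Lambda^{(0)}$ is locally compact Hausdorff. An $R$-bundle is a rigid semigroupoid homomorphism $\pi\colon\Lambda\to\Gamma$ with an $R$-bimodule structure on each fiber $\pi^{-1}(\gamma)$, $\gamma\in\Gamma$, such that for $(\gamma_1,\gamma_2)\in\Gamma^{(2)}$ the product $\pi^{-1}(\gamma_1)\times\pi^{-1}(\gamma_2)\to\pi^{-1}(\gamma_1\gamma_2)$ is biadditive, satisfies $(xr)y=x(ry)$, and induces an $R$-bimodule homomorphism on $\pi^{-1}(\gamma_1)\otimes_R\pi^{-1}(\gamma_2)$. $0_\gamma$ is the zero of $\pi^{-1}(\gamma)$. The bundle is continuous if $\Lambda,\Gamma$ are topological semigroupoids and $\pi$, the fiberwise addition, the left and right scalar multiplications, and $\gamma\mapsto0_\gamma$ are continuous. A section of $\pi$ is a map $\alpha\colon\Gamma\to\Lambda$ with $\pi\circ\alpha=\mathrm{id}_\Gamma$; $\operatorname{supp}(\alpha)$ is the closure of $\{\gamma:\alpha(\gamma)\ne0_\gamma\}$. For $V\subseteq\Gamma$ open, $C_c(V,\pi)$ is the set of sections that are zero outside $V$, continuous on $V$, with $\operatorname{supp}(\alpha)\cap V$ compact. The sectional algebra $\mathcal{A}(\pi)$ is the $R$-bimodule (pointwise operations) generated by all $C_c(V,\pi)$, $V$ open Hausdorff, with product $(\alpha\ast\beta)(\gamma)=\sum_{ab=\gamma}\alpha(a)\beta(b)$. *)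

theory Defs
  imports "HOL-Analysis.Analysis" "HOL-Algebra.FiniteProduct"
begin

section \<open>General topology\<close>

definition compact_open_topology ::
    "'x topology \<Rightarrow> 'y topology \<Rightarrow> ('x \<Rightarrow> 'y) set \<Rightarrow> ('x \<Rightarrow> 'y) topology" where
  "compact_open_topology X Y F =
     topology_generated_by {{f \<in> F. f ` K \<subseteq> V} | K V. compactin X K \<and> openin Y V}"

(* The library's proper_map is a different notion: closed with compact fibres. *)
definition compact_proper_map :: "'x topology \<Rightarrow> 'y topology \<Rightarrow> ('x \<Rightarrow> 'y) \<Rightarrow> bool" where
  "compact_proper_map X Y f \<longleftrightarrow> continuous_map X Y f \<and>
     (\<forall>K. compactin Y K \<longrightarrow> compactin X {x \<in> topspace X. f x \<in> K})"

definition local_homeomorphic_map :: "'x topology \<Rightarrow> 'y topology \<Rightarrow> ('x \<Rightarrow> 'y) \<Rightarrow> bool" where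
  "local_homeomorphic_map X Y f \<longleftrightarrow>
     (\<forall>x \<in> topspace X. \<exists>U. openin X U \<and> x \<in> U \<and> openin Y (f ` U) \<and>
        homeomorphic_map (subtopology X U) (subtopology Y (f ` U)) f)"

definition R_normal_space ::
    "'r::{ring,topological_ab_group_add,topological_monoid_mult} itself \<Rightarrow> 'x topology \<Rightarrow> bool" where
  "R_normal_space R X \<longleftrightarrow>
     (\<forall>A B. closedin X A \<and> closedin X B \<and> disjnt A B \<longrightarrow>
        (\<exists>f :: 'x \<Rightarrow> 'r. continuous_map X euclidean f \<and>
           (\<forall>x\<in>A. f x = 0) \<and> (\<forall>x\<in>B. f x = 1)))"

definition locally_R_normal_space ::
    "'r::{ring,topological_ab_group_add,topological_monoid_mult} itself \<Rightarrow> 'x topology \<Rightarrow> bool" where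
  "locally_R_normal_space R X \<longleftrightarrow>
     neighbourhood_base_of (\<lambda>S. R_normal_space R (subtopology X S)) X"


section \<open>Bimodules and topological algebras over a unital ring\<close>

text \<open>
  Scalars form a type of sort \<open>{ring, monoid_mult}\<close>, i.e. an associative unital ring, not
  necessarily commutative; unlike \<open>ring_1\<close> this sort does not require \<open>0 \<noteq> 1\<close>.  Modules live
  on carrier sets.  The additive group of a module is an abelian group in the sense of HOL-Algebra,
  whose multiplicative notation (\<open>\<otimes>\<close>, \<open>\<one>\<close>, \<open>finprod\<close>) therefore stands for sum and zero.
\<close>

abbreviation add_group :: "'m set \<Rightarrow> ('m \<Rightarrow> 'm \<Rightarrow> 'm) \<Rightarrow> 'm \<Rightarrow> 'm monoid" where
  "add_group M add zero \<equiv> \<lparr>carrier = M, monoid.mult = add, one = zero\<rparr>"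

locale bimodule =
  fixes M :: "'m set"
    and add :: "'m \<Rightarrow> 'm \<Rightarrow> 'm"
    and zero :: 'm
    and lsc :: "'r::{ring,monoid_mult} \<Rightarrow> 'm \<Rightarrow> 'm"
    and rsc :: "'m \<Rightarrow> 'r \<Rightarrow> 'm"
  assumes additive_group: "comm_group (add_group M add zero)"
    and lsc_closed: "x \<in> M \<Longrightarrow> lsc r x \<in> M"
    and lsc_add: "\<lbrakk>x \<in> M; y \<in> M\<rbrakk> \<Longrightarrow> lsc r (add x y) = add (lsc r x) (lsc r y)"
    and add_lsc: "x \<in> M \<Longrightarrow> lsc (r + s) x = add (lsc r x) (lsc s x)"
    and mult_lsc: "x \<in> M \<Longrightarrow> lsc (r * s) x = lsc r (lsc s x)"
    and one_lsc: "x \<in> M \<Longrightarrow> lsc 1 x = x"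
    and rsc_closed: "x \<in> M \<Longrightarrow> rsc x r \<in> M"
    and rsc_add: "\<lbrakk>x \<in> M; y \<in> M\<rbrakk> \<Longrightarrow> rsc (add x y) r = add (rsc x r) (rsc y r)"
    and add_rsc: "x \<in> M \<Longrightarrow> rsc x (r + s) = add (rsc x r) (rsc x s)"
    and mult_rsc: "x \<in> M \<Longrightarrow> rsc x (r * s) = rsc (rsc x r) s"
    and one_rsc: "x \<in> M \<Longrightarrow> rsc x 1 = x"
    and lsc_rsc: "x \<in> M \<Longrightarrow> lsc r (rsc x s) = rsc (lsc r x) s"

locale bimodule_algebra = bimodule M add zero lsc rsc
  for M :: "'m set" and add zero
    and lsc :: "'r::{ring,monoid_mult} \<Rightarrow> 'm \<Rightarrow> 'm" and rsc +
  fixes prd :: "'m \<Rightarrow> 'm \<Rightarrow> 'm"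
  assumes prd_closed: "\<lbrakk>x \<in> M; y \<in> M\<rbrakk> \<Longrightarrow> prd x y \<in> M"
    and prd_assoc: "\<lbrakk>x \<in> M; y \<in> M; z \<in> M\<rbrakk> \<Longrightarrow> prd (prd x y) z = prd x (prd y z)"
    and add_prd: "\<lbrakk>x \<in> M; y \<in> M; z \<in> M\<rbrakk> \<Longrightarrow> prd (add x y) z = add (prd x z) (prd y z)"
    and prd_add: "\<lbrakk>x \<in> M; y \<in> M; z \<in> M\<rbrakk> \<Longrightarrow> prd x (add y z) = add (prd x y) (prd x z)"
    and prd_balanced: "\<lbrakk>x \<in> M; y \<in> M\<rbrakk> \<Longrightarrow> prd (rsc x r) y = prd x (lsc r y)"
    and lsc_prd: "\<lbrakk>x \<in> M; y \<in> M\<rbrakk> \<Longrightarrow> prd (lsc r x) y = lsc r (prd x y)"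
    and prd_rsc: "\<lbrakk>x \<in> M; y \<in> M\<rbrakk> \<Longrightarrow> prd x (rsc y r) = rsc (prd x y) r"

locale topological_algebra = bimodule_algebra M add zero lsc rsc prd
  for M :: "'m set" and add zero
    and lsc :: "'r::{ring,topological_ab_group_add,topological_monoid_mult} \<Rightarrow> 'm \<Rightarrow> 'm"
    and rsc prd +
  fixes T :: "'m topology"
  assumes topspace_eq: "topspace T = M"
    and continuous_add: "continuous_map (prod_topology T T) T (\<lambda>(x, y). add x y)"
    and continuous_prd: "continuous_map (prod_topology T T) T (\<lambda>(x, y). prd x y)"
    and continuous_lsc: "continuous_map (prod_topology euclidean T) T (\<lambda>(r, x). lsc r x)"
    and continuous_rsc: "continuous_map (prod_topology T euclidean) T (\<lambda>(x, r). rsc x r)"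


section \<open>Semigroupoids\<close>

record ('a, 'v) semigroupoid =
  arr :: "'a set"
  vrt :: "'v set"
  src :: "'a \<Rightarrow> 'v"
  rng :: "'a \<Rightarrow> 'v"
  cmp :: "'a \<Rightarrow> 'a \<Rightarrow> 'a"

definition composable :: "('a, 'v, 'm) semigroupoid_scheme \<Rightarrow> ('a \<times> 'a) set" where
  "composable G = {(a, b). a \<in> arr G \<and> b \<in> arr G \<and> src G a = rng G b}"

locale semigroupoid =
  fixes G :: "('a, 'v, 'm) semigroupoid_scheme"
  assumes src_closed: "a \<in> arr G \<Longrightarrow> src G a \<in> vrt G"
    and rng_closed: "a \<in> arr G \<Longrightarrow> rng G a \<in> vrt G"
    and cmp_closed: "(a, b) \<in> composable G \<Longrightarrow> cmp G a b \<in> arr G"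
    and src_cmp: "(a, b) \<in> composable G \<Longrightarrow> src G (cmp G a b) = src G b"
    and rng_cmp: "(a, b) \<in> composable G \<Longrightarrow> rng G (cmp G a b) = rng G a"
    and cmp_assoc: "\<lbrakk>(a, b) \<in> composable G; (b, c) \<in> composable G\<rbrakk> \<Longrightarrow>
          cmp G (cmp G a b) c = cmp G a (cmp G b c)"

definition semigroupoid_hom ::
    "('a, 'v, 'm) semigroupoid_scheme \<Rightarrow> ('b, 'w, 'n) semigroupoid_scheme \<Rightarrow> ('a \<Rightarrow> 'b) \<Rightarrow> bool" where
  "semigroupoid_hom G H \<phi> \<longleftrightarrow> \<phi> \<in> arr G \<rightarrow> arr H \<and>
     (\<forall>(a, b) \<in> composable G. (\<phi> a, \<phi> b) \<in> composable H \<and> \<phi> (cmp G a b) = cmp H (\<phi> a) (\<phi> b))"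

definition rigid_semigroupoid_hom ::
    "('a, 'v, 'm) semigroupoid_scheme \<Rightarrow> ('b, 'w, 'n) semigroupoid_scheme \<Rightarrow> ('a \<Rightarrow> 'b) \<Rightarrow> bool" where
  "rigid_semigroupoid_hom G H \<phi> \<longleftrightarrow> semigroupoid_hom G H \<phi> \<and>
     (\<forall>a \<in> arr G. \<forall>b \<in> arr G. (\<phi> a, \<phi> b) \<in> composable H \<longrightarrow> (a, b) \<in> composable G)"

record ('a, 'v) top_semigroupoid = "('a, 'v) semigroupoid" +
  arr_top :: "'a topology"
  vrt_top :: "'v topology"

abbreviation composable_top :: "('a, 'v) top_semigroupoid \<Rightarrow> ('a \<times> 'a) topology" where
  "composable_top G \<equiv> subtopology (prod_topology (arr_top G) (arr_top G)) (composable G)"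

locale topological_semigroupoid = semigroupoid G for G :: "('a, 'v) top_semigroupoid" +
  assumes topspace_arr: "topspace (arr_top G) = arr G"
    and topspace_vrt: "topspace (vrt_top G) = vrt G"
    and continuous_src: "continuous_map (arr_top G) (vrt_top G) (src G)"
    and continuous_rng: "continuous_map (arr_top G) (vrt_top G) (rng G)"
    and continuous_cmp: "continuous_map (composable_top G) (arr_top G) (\<lambda>(a, b). cmp G a b)"

locale etale_semigroupoid = topological_semigroupoid G for G :: "('a, 'v) top_semigroupoid" +
  assumes local_homeo_src: "local_homeomorphic_map (arr_top G) (vrt_top G) (src G)"
    and local_homeo_rng: "local_homeomorphic_map (arr_top G) (vrt_top G) (rng G)"
    and locally_compact_vrt: "neighbourhood_base_of (compactin (vrt_top G)) (vrt_top G)"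
    and Hausdorff_vrt: "Hausdorff_space (vrt_top G)"


section \<open>Bundles\<close>

text \<open>
  The operations of all the fibres are collected in single functions on the total space, of which
  only the values on elements of one fibre matter.
\<close>

record ('r, 'l, 'w, 'g, 'v) fibred_bimodules =
  total :: "('l, 'w) top_semigroupoid"
  base :: "('g, 'v) top_semigroupoid"
  proj :: "'l \<Rightarrow> 'g"
  fadd :: "'l \<Rightarrow> 'l \<Rightarrow> 'l"
  fzero :: "'g \<Rightarrow> 'l"
  flsc :: "'r \<Rightarrow> 'l \<Rightarrow> 'l"
  frsc :: "'l \<Rightarrow> 'r \<Rightarrow> 'l"

definition fibre :: "('r, 'l, 'w, 'g, 'v) fibred_bimodules \<Rightarrow> 'g \<Rightarrow> 'l set" where
  "fibre B \<gamma> = {x \<in> arr (total B). proj B x = \<gamma>}"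

abbreviation fibre_group :: "('r, 'l, 'w, 'g, 'v) fibred_bimodules \<Rightarrow> 'g \<Rightarrow> 'l monoid" where
  "fibre_group B \<gamma> \<equiv> add_group (fibre B \<gamma>) (fadd B) (fzero B \<gamma>)"

(* The last two assumptions say that the additive map induced by the (balanced, biadditive) product
   on the tensor product of two fibres, with r(x \<otimes> y) = rx \<otimes> y and (x \<otimes> y)r = x \<otimes> yr,
   is a bimodule homomorphism. *)
locale R_bundle =
  fixes B :: "('r::{ring,monoid_mult}, 'l, 'w, 'g, 'v) fibred_bimodules"
  assumes semigroupoid_total: "semigroupoid (total B)"
    and semigroupoid_base: "semigroupoid (base B)"
    and rigid_proj: "rigid_semigroupoid_hom (total B) (base B) (proj B)"
    and fibre_bimodule:
      "\<gamma> \<in> arr (base B) \<Longrightarrow> bimodule (fibre B \<gamma>) (fadd B) (fzero B \<gamma>) (flsc B) (frsc B)"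
    and fibre_add_prd:
      "\<lbrakk>(\<gamma>, \<delta>) \<in> composable (base B); x \<in> fibre B \<gamma>; x' \<in> fibre B \<gamma>; y \<in> fibre B \<delta>\<rbrakk> \<Longrightarrow>
         cmp (total B) (fadd B x x') y = fadd B (cmp (total B) x y) (cmp (total B) x' y)"
    and fibre_prd_add:
      "\<lbrakk>(\<gamma>, \<delta>) \<in> composable (base B); x \<in> fibre B \<gamma>; y \<in> fibre B \<delta>; y' \<in> fibre B \<delta>\<rbrakk> \<Longrightarrow>
         cmp (total B) x (fadd B y y') = fadd B (cmp (total B) x y) (cmp (total B) x y')"
    and fibre_prd_balanced:
      "\<lbrakk>(\<gamma>, \<delta>) \<in> composable (base B); x \<in> fibre B \<gamma>; y \<in> fibre B \<delta>\<rbrakk> \<Longrightarrow>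
         cmp (total B) (frsc B x r) y = cmp (total B) x (flsc B r y)"
    and fibre_lsc_prd:
      "\<lbrakk>(\<gamma>, \<delta>) \<in> composable (base B); x \<in> fibre B \<gamma>; y \<in> fibre B \<delta>\<rbrakk> \<Longrightarrow>
         cmp (total B) (flsc B r x) y = flsc B r (cmp (total B) x y)"
    and fibre_prd_rsc:
      "\<lbrakk>(\<gamma>, \<delta>) \<in> composable (base B); x \<in> fibre B \<gamma>; y \<in> fibre B \<delta>\<rbrakk> \<Longrightarrow>
         cmp (total B) x (frsc B y r) = frsc B (cmp (total B) x y) r"

locale continuous_R_bundle = R_bundle B
  for B :: "('r::{ring,topological_ab_group_add,topological_monoid_mult}, 'l, 'w, 'g, 'v) fibred_bimodules" +
  assumes topological_total: "topological_semigroupoid (total B)"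
    and topological_base: "topological_semigroupoid (base B)"
    and continuous_proj: "continuous_map (arr_top (total B)) (arr_top (base B)) (proj B)"
    and continuous_fadd:
      "continuous_map
         (subtopology (prod_topology (arr_top (total B)) (arr_top (total B)))
            {(x, y). x \<in> arr (total B) \<and> y \<in> arr (total B) \<and> proj B x = proj B y})
         (arr_top (total B)) (\<lambda>(x, y). fadd B x y)"
    and continuous_flsc:
      "continuous_map (prod_topology euclidean (arr_top (total B))) (arr_top (total B))
         (\<lambda>(r, x). flsc B r x)"
    and continuous_frsc:
      "continuous_map (prod_topology (arr_top (total B)) euclidean) (arr_top (total B))
         (\<lambda>(x, r). frsc B x r)"
    and continuous_fzero: "continuous_map (arr_top (base B)) (arr_top (total B)) (fzero B)"


section \<open>The sectional algebra\<close>

(* Sections are extensional, i.e. undefined outside the base, so that equality of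
   sections is equality on the base. *)
definition sections :: "('r, 'l, 'w, 'g, 'v) fibred_bimodules \<Rightarrow> ('g \<Rightarrow> 'l) set" where
  "sections B = (\<Pi>\<^sub>E \<gamma>\<in>arr (base B). fibre B \<gamma>)"

definition supp :: "('r, 'l, 'w, 'g, 'v) fibred_bimodules \<Rightarrow> ('g \<Rightarrow> 'l) \<Rightarrow> 'g set" where
  "supp B \<alpha> = arr_top (base B) closure_of {\<gamma> \<in> arr (base B). \<alpha> \<gamma> \<noteq> fzero B \<gamma>}"

definition Cc :: "('r, 'l, 'w, 'g, 'v) fibred_bimodules \<Rightarrow> 'g set \<Rightarrow> ('g \<Rightarrow> 'l) set" where
  "Cc B V = {\<alpha> \<in> sections B.
     (\<forall>\<gamma> \<in> arr (base B) - V. \<alpha> \<gamma> = fzero B \<gamma>) \<and>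
     continuous_map (subtopology (arr_top (base B)) V) (arr_top (total B)) \<alpha> \<and>
     compactin (arr_top (base B)) (supp B \<alpha> \<inter> V)}"

definition sec_zero :: "('r, 'l, 'w, 'g, 'v) fibred_bimodules \<Rightarrow> 'g \<Rightarrow> 'l" where
  "sec_zero B = (\<lambda>\<gamma>\<in>arr (base B). fzero B \<gamma>)"

definition sec_add :: "('r, 'l, 'w, 'g, 'v) fibred_bimodules \<Rightarrow> ('g \<Rightarrow> 'l) \<Rightarrow> ('g \<Rightarrow> 'l) \<Rightarrow> 'g \<Rightarrow> 'l" where
  "sec_add B \<alpha> \<beta> = (\<lambda>\<gamma>\<in>arr (base B). fadd B (\<alpha> \<gamma>) (\<beta> \<gamma>))"

definition sec_lsc :: "('r, 'l, 'w, 'g, 'v) fibred_bimodules \<Rightarrow> 'r \<Rightarrow> ('g \<Rightarrow> 'l) \<Rightarrow> 'g \<Rightarrow> 'l" where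
  "sec_lsc B r \<alpha> = (\<lambda>\<gamma>\<in>arr (base B). flsc B r (\<alpha> \<gamma>))"

definition sec_rsc :: "('r, 'l, 'w, 'g, 'v) fibred_bimodules \<Rightarrow> ('g \<Rightarrow> 'l) \<Rightarrow> 'r \<Rightarrow> 'g \<Rightarrow> 'l" where
  "sec_rsc B \<alpha> r = (\<lambda>\<gamma>\<in>arr (base B). frsc B (\<alpha> \<gamma>) r)"

(* No clause for additive inverses is needed: they are the multiples by the scalar -1. *)
inductive_set sectional_algebra :: "('r, 'l, 'w, 'g, 'v) fibred_bimodules \<Rightarrow> ('g \<Rightarrow> 'l) set"
  for B :: "('r, 'l, 'w, 'g, 'v) fibred_bimodules" where
  Cc: "\<lbrakk>openin (arr_top (base B)) V; Hausdorff_space (subtopology (arr_top (base B)) V);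
        \<alpha> \<in> Cc B V\<rbrakk> \<Longrightarrow> \<alpha> \<in> sectional_algebra B"
| zero: "sec_zero B \<in> sectional_algebra B"
| add: "\<lbrakk>\<alpha> \<in> sectional_algebra B; \<beta> \<in> sectional_algebra B\<rbrakk> \<Longrightarrow>
        sec_add B \<alpha> \<beta> \<in> sectional_algebra B"
| lsc: "\<alpha> \<in> sectional_algebra B \<Longrightarrow> sec_lsc B r \<alpha> \<in> sectional_algebra B"
| rsc: "\<alpha> \<in> sectional_algebra B \<Longrightarrow> sec_rsc B \<alpha> r \<in> sectional_algebra B"

(* The sum over the factorisations of \<gamma> is taken over the nonzero terms only, because there may be
   infinitely many factorisations, and finprod is trivial on infinite index sets. *)
definition sec_conv :: "('r, 'l, 'w, 'g, 'v) fibred_bimodules \<Rightarrow> ('g \<Rightarrow> 'l) \<Rightarrow> ('g \<Rightarrow> 'l) \<Rightarrow> 'g \<Rightarrow> 'l" where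
  "sec_conv B \<alpha> \<beta> = (\<lambda>\<gamma>\<in>arr (base B).
     finprod (fibre_group B \<gamma>) (\<lambda>(a, b). cmp (total B) (\<alpha> a) (\<beta> b))
       {(a, b) \<in> composable (base B).
          cmp (base B) a b = \<gamma> \<and> cmp (total B) (\<alpha> a) (\<beta> b) \<noteq> fzero B \<gamma>})"

end

theory Submission
  imports Defs
begin

text \<open>
  Write \<open>\<Gamma>\<close> for the base, \<open>\<Lambda>\<close> for the total space and \<open>\<mu>\<close> for the multiplication of \<open>\<Gamma>\<close>, a map
  defined on the composable pairs.

  The first point is that \<open>\<mu>\<close> is a finite covering over its image, with a number of sheets that may
  vary.  It is open and locally injective because the range and source maps are local
  homeomorphisms and \<open>ab\<close> determines the range of \<open>a\<close> and the source of \<open>b\<close>; it is closed because it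
  pulls compact sets back to compact sets and \<open>\<Gamma>\<close> is locally compact Hausdorff.  Its fibres are
  therefore compact and discrete, so finite, and near a point \<open>\<gamma>\<close> all factorizations of an
  arrow \<open>\<delta>\<close> are the values \<open>\<sigma>\<^sub>p(\<delta>)\<close> of finitely many continuous local sections of \<open>\<mu>\<close>, one for each
  factorization \<open>p\<close> of \<open>\<gamma>\<close> (\<open>factorizations_local_sections\<close>).  Locally, the convolution
  \<open>(\<alpha> * \<beta>)(\<delta>)\<close> is thus a fibrewise sum with a fixed finite index set, whose terms are continuous in
  \<open>\<delta>\<close>.

  The second point is that the compact-open topology obeys an exponential law.  A continuous map
  \<open>Z \<times> \<Gamma> \<rightarrow> \<Lambda>\<close> whose slices lie in the sectional algebra is a continuous map from \<open>Z\<close> to the sectional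
  algebra, and evaluation \<open>(\<alpha>, \<gamma>) \<mapsto> \<alpha>(\<gamma>)\<close> is jointly continuous because \<open>\<Gamma>\<close> is locally compact.
  Continuity of each algebra operation is thereby reduced to joint continuity of a map such as
  \<open>(\<alpha>, \<beta>, \<gamma>) \<mapsto> (\<alpha> * \<beta>)(\<gamma>)\<close>.  For the module operations it is read off the continuity of the operations
  of the bundle, and for the convolution it follows from its local form as a finite sum
  (\<open>continuous_map_sec_conv\<close>).

  As \<open>\<Gamma>\<close> is Hausdorff, the sectional algebra consists of the continuous sections that vanish
  outside a compact set (\<open>sectional_algebra_iff\<close>).  Such sections are closed under convolution
  because a product of two compact sets of arrows is compact.  The algebraic laws
  are those of the fibres, summed over factorizations; associativity is the statement that both
  bracketings sum over the ways to write \<open>\<gamma> = abc\<close>.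
\<close>

section \<open>The exponential law for the compact-open topology\<close>

lemma topspace_compact_open [simp]: "topspace (compact_open_topology X Y F) = F"
proof -
  \<comment> \<open>the empty compact set imposes no condition\<close>
  have "F \<in> {{f \<in> F. f ` K \<subseteq> V} | K V. compactin X K \<and> openin Y V}"
    by (intro CollectI exI[of _ "{}"]) auto
  then show ?thesis
    unfolding compact_open_topology_def topology_generated_by_topspace by blast
qed

text \<open>
  Currying.  If \<open>\<Phi> z\<close> maps a compact set \<open>K\<close> into an open set \<open>V\<close>, then the tube lemma yields a
  neighbourhood of \<open>z\<close> all of whose members behave in the same way.
\<close>

lemma continuous_map_into_compact_open:
  assumes cont: "continuous_map (prod_topology Z X) Y (\<lambda>(z, x). \<Phi> z x)"
    and into: "\<And>z. z \<in> topspace Z \<Longrightarrow> \<Phi> z \<in> F"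
  shows "continuous_map Z (compact_open_topology X Y F) \<Phi>"
  unfolding compact_open_topology_def
proof (rule continuous_on_generated_topo)
  show "\<Phi> ` topspace Z \<subseteq> \<Union> {{f \<in> F. f ` K \<subseteq> V} | K V. compactin X K \<and> openin Y V}"
    using into topspace_compact_open[of X Y F]
    unfolding compact_open_topology_def topology_generated_by_topspace by blast
next
  fix U assume "U \<in> {{f \<in> F. f ` K \<subseteq> V} | K V. compactin X K \<and> openin Y V}"
  then obtain K V where U: "U = {f \<in> F. f ` K \<subseteq> V}" and K: "compactin X K" and V: "openin Y V"
    by blast
  define W where "W = {p \<in> topspace (prod_topology Z X). \<Phi> (fst p) (snd p) \<in> V}"
  have W: "openin (prod_topology Z X) W"
    using openin_continuous_map_preimage[OF cont V] unfolding W_def case_prod_unfold .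
  show "openin Z (\<Phi> -` U \<inter> topspace Z)"
  proof (subst openin_subopen, intro ballI)
    fix z assume z: "z \<in> \<Phi> -` U \<inter> topspace Z"
    then have "z \<in> topspace Z" "\<Phi> z ` K \<subseteq> V" unfolding U by blast+
    then have "{z} \<times> K \<subseteq> W"
      using compactin_subset_topspace[OF K] by (auto simp: W_def)
    then obtain N M where NM: "openin Z N" "z \<in> N" "K \<subseteq> M" "N \<times> M \<subseteq> W"
      using tube_lemma_right[OF W K \<open>z \<in> topspace Z\<close> \<open>{z} \<times> K \<subseteq> W\<close>] by blast
    have "\<Phi> n k \<in> V" if "n \<in> N" "k \<in> K" for n k
    proof -
      have "(n, k) \<in> W" using NM(3,4) that by blast
      then show ?thesis by (simp add: W_def)
    qed
    then have "N \<subseteq> \<Phi> -` U \<inter> topspace Z"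
      using openin_subset[OF NM(1)] into by (auto simp: U)
    with NM show "\<exists>T. openin Z T \<and> z \<in> T \<and> T \<subseteq> \<Phi> -` U \<inter> topspace Z" by blast
  qed
qed

text \<open>
  Near \<open>(f, x)\<close>, a compact neighbourhood \<open>K\<close> of \<open>x\<close> contained in the preimage of \<open>V\<close> under \<open>f\<close>
  controls both variables at once: every \<open>g\<close> with \<open>g(K) \<subseteq> V\<close> maps every point of \<open>K\<close> into \<open>V\<close>.
\<close>

lemma continuous_map_compact_open_eval:
  assumes nbd: "neighbourhood_base_of (compactin X) X"
    and F: "\<And>f. f \<in> F \<Longrightarrow> continuous_map X Y f"
  shows "continuous_map (prod_topology (compact_open_topology X Y F) X) Y (\<lambda>(f, x). f x)"
  unfolding continuous_map_def case_prod_unfold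
proof (intro conjI allI impI)
  show "(\<lambda>p. fst p (snd p)) \<in> topspace (prod_topology (compact_open_topology X Y F) X) \<rightarrow> topspace Y"
  proof
    fix p assume "p \<in> topspace (prod_topology (compact_open_topology X Y F) X)"
    then have "fst p \<in> F" "snd p \<in> topspace X" by auto
    then show "fst p (snd p) \<in> topspace Y"
      using continuous_map_funspace[OF F] by blast
  qed
next
  fix V assume V: "openin Y V"
  let ?T = "compact_open_topology X Y F"
  let ?P = "{p \<in> topspace (prod_topology ?T X). fst p (snd p) \<in> V}"
  show "openin (prod_topology ?T X) ?P"
  proof (subst openin_subopen, intro ballI)
    fix p assume "p \<in> ?P"
    then obtain f x where p: "p = (f, x)" and f: "f \<in> F" and x: "x \<in> topspace X" "f x \<in> V"
      by auto
    have "openin X {x \<in> topspace X. f x \<in> V}"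
      using openin_continuous_map_preimage[OF F[OF f] V] .
    then obtain U K
      where UK: "openin X U" "compactin X K" "x \<in> U" "U \<subseteq> K" "K \<subseteq> {x \<in> topspace X. f x \<in> V}"
      using nbd x unfolding neighbourhood_base_of
      by (metis (no_types, lifting) mem_Collect_eq)
    let ?N = "{f \<in> F. f ` K \<subseteq> V}"
    have "openin ?T ?N"
      unfolding compact_open_topology_def
      by (rule topology_generated_by_Basis) (use UK V in blast)
    with UK have "openin (prod_topology ?T X) (?N \<times> U)"
      by (simp add: openin_prod_Times_iff)
    moreover have "p \<in> ?N \<times> U" using p f UK by auto
    moreover have "?N \<times> U \<subseteq> ?P"
    proof
      fix q assume "q \<in> ?N \<times> U"
      then have q: "fst q \<in> F" "fst q ` K \<subseteq> V" "snd q \<in> U" by auto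
      then have "snd q \<in> topspace X" "fst q (snd q) \<in> V"
        using UK(4) openin_subset[OF UK(1)] by blast+
      with q show "q \<in> ?P" by (simp add: mem_Times_iff)
    qed
    ultimately show "\<exists>N. openin (prod_topology ?T X) N \<and> p \<in> N \<and> N \<subseteq> ?P" by blast
  qed
qed

lemma continuous_map_locally:
  assumes "\<And>x. x \<in> topspace X \<Longrightarrow> \<exists>U. openin X U \<and> x \<in> U \<and> continuous_map (subtopology X U) Y f"
  shows "continuous_map X Y f"
proof (rule pasting_lemma[where I = "{U. openin X U \<and> continuous_map (subtopology X U) Y f}"
      and T = "\<lambda>U. U" and f = "\<lambda>_. f"])
qed (use assms in auto)

section \<open>Finite coverings\<close>

text \<open>
  An open set on which \<open>f\<close> is injective meets the fibre in at most one point, and finitely many of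
  these sets cover the compact fibre.
\<close>

lemma finite_fibre_of_locally_injective:
  assumes "compactin X {x \<in> topspace X. f x = y}"
    and inj: "\<And>x. x \<in> topspace X \<Longrightarrow> \<exists>U. openin X U \<and> x \<in> U \<and> inj_on f U"
  shows "finite {x \<in> topspace X. f x = y}"
proof -
  let ?F = "{x \<in> topspace X. f x = y}"
  let ?\<U> = "{U. openin X U \<and> inj_on f U}"
  have "?F \<subseteq> \<Union> ?\<U>" using inj by blast
  then obtain \<V> where \<V>: "finite \<V>" "\<V> \<subseteq> ?\<U>" "?F \<subseteq> \<Union> \<V>"
    using assms(1) unfolding compactin_def by (metis (no_types, lifting) mem_Collect_eq)
  have "finite (?F \<inter> U)" if U: "U \<in> \<V>" for U
  proof (cases "?F \<inter> U = {}")
    case False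
    then obtain x where x: "x \<in> ?F \<inter> U" by blast
    have "inj_on f U" using U \<V>(2) by blast
    then have "?F \<inter> U \<subseteq> {x}" using x by (auto dest: inj_onD)
    then show ?thesis by (rule finite_subset) simp
  qed simp
  then have "finite (\<Union>U\<in>\<V>. ?F \<inter> U)" using \<V>(1) by blast
  moreover have "?F = (\<Union>U\<in>\<V>. ?F \<inter> U)" using \<V>(3) by blast
  ultimately show ?thesis by simp
qed

text \<open>
  Separate each point \<open>p\<close> from the compact set \<open>F - {p}\<close> by open sets \<open>U p\<close> and \<open>V p\<close>, and shrink
  \<open>U p\<close> so that it also lies in every \<open>V q\<close> with \<open>q \<noteq> p\<close>.
\<close>

lemma Hausdorff_space_finite_separation:
  assumes X: "Hausdorff_space X" and F: "finite F" "F \<subseteq> topspace X"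
  obtains N where "\<And>p. p \<in> F \<Longrightarrow> openin X (N p) \<and> p \<in> N p"
    and "\<And>p q. \<lbrakk>p \<in> F; q \<in> F; p \<noteq> q\<rbrakk> \<Longrightarrow> disjnt (N p) (N q)"
proof -
  have "\<exists>U V. openin X U \<and> openin X V \<and> p \<in> U \<and> F - {p} \<subseteq> V \<and> disjnt U V" if "p \<in> F" for p
  proof -
    have "compactin X {p}" "compactin X (F - {p})"
      using that F by (auto intro!: finite_imp_compactin)
    moreover have "disjnt {p} (F - {p})" by simp
    ultimately show ?thesis
      using Hausdorff_space_compact_separation[OF X] by (metis insert_subset)
  qed
  then obtain U V where UV: "\<And>p. p \<in> F \<Longrightarrow>
      openin X (U p) \<and> openin X (V p) \<and> p \<in> U p \<and> F - {p} \<subseteq> V p \<and> disjnt (U p) (V p)"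
    by metis
  let ?N = "\<lambda>p. \<Inter> (insert (U p) (V ` (F - {p})))"
  show thesis
  proof
    fix p assume p: "p \<in> F"
    have "openin X (?N p)"
      by (rule openin_Inter) (use F UV p in auto)
    moreover have "p \<in> ?N p" using UV p by blast
    ultimately show "openin X (?N p) \<and> p \<in> ?N p" ..
  next
    fix p q assume pq: "p \<in> F" "q \<in> F" "p \<noteq> q"
    then have "?N p \<subseteq> U p" "?N q \<subseteq> V p" by auto
    with UV[OF pq(1)] show "disjnt (?N p) (?N q)" unfolding disjnt_def by blast
  qed
qed

text \<open>
  The sections are the inverses of \<open>f\<close> on disjoint sheets around the points of the fibre over \<open>y\<close>,
  so the points of that fibre serve as their indices.  Disjointness makes the values of
  different sections distinct.  That there are no further points over a nearby \<open>w\<close> is where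
  closedness enters: \<open>f\<close> maps the complement of the sheets to a closed set, which misses \<open>y\<close> and is
  removed from \<open>W\<close>.
\<close>

lemma finite_covering_local_sections:
  assumes X: "Hausdorff_space X"
    and f: "continuous_map X Y f" "open_map X Y f" "closed_map X Y f"
    and inj: "\<And>x. x \<in> topspace X \<Longrightarrow> \<exists>U. openin X U \<and> x \<in> U \<and> inj_on f U"
    and y: "y \<in> topspace Y" and fin: "finite {x \<in> topspace X. f x = y}"
  obtains W \<sigma> where "openin Y W" "y \<in> W"
    and "\<And>p. p \<in> {x \<in> topspace X. f x = y} \<Longrightarrow> continuous_map (subtopology Y W) X (\<sigma> p)"
    and "\<And>w. w \<in> W \<Longrightarrow>
      bij_betw (\<lambda>p. \<sigma> p w) {x \<in> topspace X. f x = y} {x \<in> topspace X. f x = w}"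
proof -
  let ?F = "{x \<in> topspace X. f x = y}"
  obtain N where N: "\<And>p. p \<in> ?F \<Longrightarrow> openin X (N p) \<and> p \<in> N p"
    and disj: "\<And>p q. \<lbrakk>p \<in> ?F; q \<in> ?F; p \<noteq> q\<rbrakk> \<Longrightarrow> disjnt (N p) (N q)"
    using Hausdorff_space_finite_separation[OF X fin] by blast
  obtain I where I: "\<And>p. p \<in> ?F \<Longrightarrow> openin X (I p) \<and> p \<in> I p \<and> inj_on f (I p)"
    using inj by (metis (no_types, lifting) mem_Collect_eq)
  define U where "U p = N p \<inter> I p" for p
  have U: "openin X (U p)" "p \<in> U p" "inj_on f (U p)" "U p \<subseteq> topspace X" if "p \<in> ?F" for p
    using N[OF that] I[OF that] openin_subset
    by (auto simp: U_def intro: inj_on_subset)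
  have disjU: "p = q" if "p \<in> ?F" "q \<in> ?F" "x \<in> U p" "x \<in> U q" for p q x
    using disj[OF that(1,2)] that(3,4) unfolding U_def disjnt_def by blast
  let ?C = "topspace X - \<Union> (U ` ?F)"
  let ?W = "\<Inter> (insert (topspace Y - f ` ?C) ((\<lambda>p. f ` U p) ` ?F))"
  have C: "closedin X ?C" using U(1) by (intro closedin_diff) auto
  have fU: "openin Y (f ` U p)" if "p \<in> ?F" for p
    using f(2) U(1)[OF that] unfolding open_map_def by blast
  have hom: "\<exists>g. homeomorphic_maps (subtopology X (U p)) (subtopology Y (f ` U p)) f g" if p: "p \<in> ?F" for p
  proof -
    have "homeomorphic_map (subtopology X (U p)) (subtopology Y (f ` U p)) f"
    proof (rule bijective_open_imp_homeomorphic_map)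
      show "continuous_map (subtopology X (U p)) (subtopology Y (f ` U p)) f"
        using f(1) by (auto simp: continuous_map_in_subtopology continuous_map_from_subtopology)
      show "open_map (subtopology X (U p)) (subtopology Y (f ` U p)) f"
        unfolding open_map_def using U(1)[OF p] fU[OF p] f(2)
        by (auto simp: openin_open_subtopology open_map_def)
      show "f ` topspace (subtopology X (U p)) = topspace (subtopology Y (f ` U p))"
        using U(4)[OF p] openin_subset[OF fU[OF p]] by (simp add: Int_absorb1)
      show "inj_on f (topspace (subtopology X (U p)))"
        using U(3)[OF p] by (rule inj_on_subset) simp
    qed
    then show ?thesis using homeomorphic_map_maps by blast
  qed
  then obtain \<sigma> where \<sigma>: "\<And>p. p \<in> ?F \<Longrightarrow>
      homeomorphic_maps (subtopology X (U p)) (subtopology Y (f ` U p)) f (\<sigma> p)"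
    by metis
  have \<sigma>in: "\<sigma> p w \<in> U p \<and> f (\<sigma> p w) = w" if "p \<in> ?F" "w \<in> f ` U p" for p w
    using \<sigma>[OF that(1)] that openin_subset[OF fU[OF that(1)]]
    by (auto simp: homeomorphic_maps_def continuous_map_in_subtopology)
  have \<sigma>inv: "\<sigma> p (f x) = x" if "p \<in> ?F" "x \<in> U p" for p x
    using \<sigma>[OF that(1)] that U(4)[OF that(1)] by (auto simp: homeomorphic_maps_def)
  show thesis
  proof
    show "openin Y ?W"
      by (rule openin_Inter) (use fin fU C f(3) in \<open>auto simp: closed_map_def\<close>)
    show "y \<in> ?W" using y U(2) by blast
  next
    fix p assume p: "p \<in> ?F"
    have "continuous_map (subtopology Y (f ` U p)) X (\<sigma> p)"
      using \<sigma>[OF p] by (auto simp: homeomorphic_maps_def continuous_map_in_subtopology)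
    moreover have "?W \<subseteq> f ` U p" using p by blast
    ultimately show "continuous_map (subtopology Y ?W) X (\<sigma> p)"
      by (rule continuous_map_from_subtopology_mono)
  next
    fix w assume w: "w \<in> ?W"
    have wU: "w \<in> f ` U p" if "p \<in> ?F" for p using w that by blast
    show "bij_betw (\<lambda>p. \<sigma> p w) ?F {x \<in> topspace X. f x = w}"
      unfolding bij_betw_def
    proof
      show "inj_on (\<lambda>p. \<sigma> p w) ?F"
      proof (rule inj_onI)
        fix p q assume pq: "p \<in> ?F" "q \<in> ?F" and eq: "\<sigma> p w = \<sigma> q w"
        have "\<sigma> p w \<in> U p" "\<sigma> q w \<in> U q"
          using \<sigma>in[OF pq(1) wU[OF pq(1)]] \<sigma>in[OF pq(2) wU[OF pq(2)]] by auto
        then show "p = q" using disjU[OF pq] eq by simp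
      qed
      show "(\<lambda>p. \<sigma> p w) ` ?F = {x \<in> topspace X. f x = w}"
      proof (intro equalityI subsetI)
        fix x assume "x \<in> (\<lambda>p. \<sigma> p w) ` ?F"
        then obtain p where "p \<in> ?F" "x = \<sigma> p w" by blast
        then show "x \<in> {x \<in> topspace X. f x = w}" using \<sigma>in[OF _ wU] U(4) by blast
      next
        fix x assume x: "x \<in> {x \<in> topspace X. f x = w}"
        then have "x \<notin> ?C" using w by blast
        then obtain p where p: "p \<in> ?F" "x \<in> U p" using x by blast
        then have "x = \<sigma> p w" using \<sigma>inv[of p x] x by simp
        then show "x \<in> (\<lambda>p. \<sigma> p w) ` ?F" using p(1) by blast
      qed
    qed
  qed
qed

section \<open>Local homeomorphisms\<close>

lemma local_homeomorphic_map_locally_injective: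
  assumes "local_homeomorphic_map X Y f" "x \<in> topspace X"
  shows "\<exists>U. openin X U \<and> x \<in> U \<and> inj_on f U"
proof -
  obtain U where U: "openin X U" "x \<in> U" "homeomorphic_map (subtopology X U) (subtopology Y (f ` U)) f"
    using assms unfolding local_homeomorphic_map_def by blast
  then have "inj_on f U"
    using homeomorphic_imp_injective_map[OF U(3)] openin_subset[OF U(1)] by (simp add: Int_absorb1)
  with U show ?thesis by blast
qed

lemma local_homeomorphic_map_open_map:
  assumes f: "local_homeomorphic_map X Y f"
  shows "open_map X Y f"
  unfolding open_map_def
proof (intro allI impI)
  fix N assume N: "openin X N"
  show "openin Y (f ` N)"
  proof (subst openin_subopen, intro ballI)
    fix y assume "y \<in> f ` N"
    then obtain x where x: "x \<in> N" "y = f x" by blast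
    then obtain U where U: "openin X U" "x \<in> U" "openin Y (f ` U)"
      "homeomorphic_map (subtopology X U) (subtopology Y (f ` U)) f"
      using f openin_subset[OF N] unfolding local_homeomorphic_map_def by blast
    have "openin (subtopology X U) (N \<inter> U)" using N by (simp add: openin_subtopology_Int)
    then have "openin (subtopology Y (f ` U)) (f ` (N \<inter> U))"
      using homeomorphic_imp_open_map[OF U(4)] unfolding open_map_def by blast
    then have "openin Y (f ` (N \<inter> U))" using U(3) openin_trans_full by blast
    moreover have "y \<in> f ` (N \<inter> U)" "f ` (N \<inter> U) \<subseteq> f ` N" using x U(2) by auto
    ultimately show "\<exists>T. openin Y T \<and> y \<in> T \<and> T \<subseteq> f ` N" by blast
  qed
qed

lemma local_homeomorphic_map_locally_compact:
  assumes f: "local_homeomorphic_map X Y f" "f \<in> topspace X \<rightarrow> topspace Y"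
    and Y: "Hausdorff_space Y" "locally_compact_space Y"
  shows "locally_compact_space X"
  unfolding locally_compact_space_def
proof (intro ballI)
  fix x assume x: "x \<in> topspace X"
  then obtain U where U: "openin X U" "x \<in> U" "openin Y (f ` U)"
      "homeomorphic_map (subtopology X U) (subtopology Y (f ` U)) f"
    using f(1) unfolding local_homeomorphic_map_def by blast
  have "locally_compact_space (subtopology Y (f ` U))"
    using Y U(3) locally_compact_space_open_subset by blast
  then have "locally_compact_space (subtopology X U)"
    using homeomorphic_locally_compact_space[OF homeomorphic_map_imp_homeomorphic_space[OF U(4)]] by blast
  moreover have "x \<in> topspace (subtopology X U)" using x U(2) by simp
  ultimately obtain V K where VK: "openin (subtopology X U) V" "compactin (subtopology X U) K" "x \<in> V" "V \<subseteq> K"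
    unfolding locally_compact_space_def by blast
  have "openin X V" "compactin X K"
    using openin_trans_full[OF VK(1) U(1)] VK(2) by (auto simp: compactin_subtopology)
  with VK(3,4) show "\<exists>U K. openin X U \<and> compactin X K \<and> x \<in> U \<and> U \<subseteq> K" by blast
qed

section \<open>Finite sums in commutative monoids\<close>

text \<open>
  Stated for two different monoids, because multiplication by an element of one fibre is an
  additive map between two other fibres.
\<close>

lemma finprod_hom:
  assumes "comm_monoid G" "comm_monoid H"
    and h: "h \<in> carrier G \<rightarrow> carrier H" "h \<one>\<^bsub>G\<^esub> = \<one>\<^bsub>H\<^esub>"
      "\<And>x y. \<lbrakk>x \<in> carrier G; y \<in> carrier G\<rbrakk> \<Longrightarrow> h (x \<otimes>\<^bsub>G\<^esub> y) = h x \<otimes>\<^bsub>H\<^esub> h y"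
    and f: "f \<in> I \<rightarrow> carrier G"
  shows "h (finprod G f I) = finprod H (\<lambda>i. h (f i)) I"
proof -
  interpret G: comm_monoid G by fact
  interpret H: comm_monoid H by fact
  show ?thesis
    using f
  proof (induction I rule: infinite_finite_induct)
    case (insert i I)
    then have "f i \<in> carrier G" "f \<in> I \<rightarrow> carrier G" "(\<lambda>i. h (f i)) \<in> I \<rightarrow> carrier H"
      using h(1) by auto
    moreover have "h (f i) \<in> carrier H" using h(1) \<open>f i \<in> carrier G\<close> by blast
    ultimately show ?case
      using insert.hyps insert.IH h(3) by (simp add: G.finprod_closed)
  qed (simp_all add: h(2))
qed

lemma (in comm_monoid) finprod_Sigma:
  assumes "finite I" "\<And>i. i \<in> I \<Longrightarrow> finite (J i)"
    and f: "\<And>i j. \<lbrakk>i \<in> I; j \<in> J i\<rbrakk> \<Longrightarrow> f (i, j) \<in> carrier G"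
  shows "finprod G (\<lambda>i. finprod G (\<lambda>j. f (i, j)) (J i)) I = finprod G f (Sigma I J)"
proof -
  have inner: "finprod G (\<lambda>j. f (i, j)) (J i) = finprod G f (Pair i ` J i)" if "i \<in> I" for i
    by (rule finprod_reindex[symmetric]) (use f that in \<open>auto intro: inj_onI\<close>)
  have "finprod G (\<lambda>i. finprod G (\<lambda>j. f (i, j)) (J i)) I
      = finprod G (\<lambda>i. finprod G f (Pair i ` J i)) I"
    by (rule finprod_cong') (use inner f in \<open>auto intro!: finprod_closed\<close>)
  also have "\<dots> = finprod G f (\<Union>i\<in>I. Pair i ` J i)"
    by (rule finprod_UN_disjoint[symmetric]) (use assms in \<open>auto simp: pairwise_def disjnt_def\<close>)
  also have "(\<Union>i\<in>I. Pair i ` J i) = Sigma I J" by auto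
  finally show ?thesis .
qed

section \<open>Fibres\<close>

text \<open>
  Scalar multiplication is additive, so \<open>r0\<close>, \<open>0r\<close> and \<open>0x\<close> are idempotent for the addition and
  hence vanish by cancellation; the last of these makes \<open>(-1)x\<close> the inverse of \<open>x\<close>.
\<close>

lemma bimodule_zero_and_inverse:
  assumes "bimodule M add zero lsc rsc"
  shows "zero \<in> M" "lsc r zero = zero" "rsc zero r = zero"
    and "x \<in> M \<Longrightarrow> add zero x = x" "x \<in> M \<Longrightarrow> add (lsc (- 1) x) x = zero"
proof -
  interpret bimodule M add zero lsc rsc by fact
  interpret G: comm_group "add_group M add zero" by (rule additive_group)
  show z: "zero \<in> M" using G.one_closed by simp
  have idem: "x = zero" if "x \<in> M" "add x x = x" for x
    using G.l_cancel_one[of x x] that by simp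
  have zz: "add zero zero = zero" using G.l_one[of zero] z by simp
  show "lsc r zero = zero" using lsc_add[OF z z, of r] zz by (intro idem lsc_closed z) simp
  show "rsc zero r = zero" using rsc_add[OF z z, of r] zz by (intro idem rsc_closed z) simp
  show "add zero x = x" if "x \<in> M" using G.l_one[of x] that by simp
  show "add (lsc (- 1) x) x = zero" if x: "x \<in> M"
  proof -
    have "add (lsc 0 x) (lsc 0 x) = lsc 0 x" using add_lsc[OF x, of 0 0] by simp
    then have "lsc 0 x = zero" by (rule idem[OF lsc_closed[OF x]])
    then show ?thesis using add_lsc[OF x, of "- 1" 1] one_lsc[OF x] by simp
  qed
qed

text \<open>
  The fibre of the multiplication.  It serves as an index set of the convolution that depends on
  \<open>\<gamma>\<close> only and not on which summands vanish.
\<close>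

definition factorizations :: "('a, 'v, 'm) semigroupoid_scheme \<Rightarrow> 'a \<Rightarrow> ('a \<times> 'a) set" where
  "factorizations G \<gamma> = {p \<in> composable G. cmp G (fst p) (snd p) = \<gamma>}"

text \<open>
  Both sides list the triples \<open>(a, b, c)\<close> with \<open>abc = \<gamma>\<close>, the left one as a factorization
  \<open>(ab, c)\<close> of \<open>\<gamma>\<close> refined by \<open>(a, b)\<close>, the right one as \<open>(a, bc)\<close> refined by \<open>(b, c)\<close>.
\<close>

lemma (in semigroupoid) bij_betw_triple_factorizations:
  "bij_betw (\<lambda>((x, c), (a, b)). ((a, cmp G b c), (b, c)))
     (SIGMA p:factorizations G \<gamma>. factorizations G (fst p))
     (SIGMA p:factorizations G \<gamma>. factorizations G (snd p))"
    (is "bij_betw ?h ?L ?R")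
proof -
  let ?k = "\<lambda>((a, y), (b, c)). ((cmp G a b, c), (a, b))"
  have L: "?h t \<in> ?R \<and> ?k (?h t) = t" if t: "t \<in> ?L" for t
  proof -
    obtain x c a b where t_eq: "t = ((x, c), (a, b))" by (cases t) force
    have xc: "(x, c) \<in> composable G" "cmp G x c = \<gamma>" and ab: "(a, b) \<in> composable G" "cmp G a b = x"
      using t by (auto simp: t_eq factorizations_def)
    have bc: "(b, c) \<in> composable G"
      using xc(1) ab src_cmp[OF ab(1)] by (auto simp: composable_def)
    have "(a, cmp G b c) \<in> composable G"
      using ab(1) bc rng_cmp[OF bc] cmp_closed[OF bc] by (auto simp: composable_def)
    with cmp_assoc[OF ab(1) bc] bc xc ab show ?thesis by (simp add: t_eq factorizations_def)
  qed
  have R: "?k t \<in> ?L \<and> ?h (?k t) = t" if t: "t \<in> ?R" for t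
  proof -
    obtain a y b c where t_eq: "t = ((a, y), (b, c))" by (cases t) force
    have ay: "(a, y) \<in> composable G" "cmp G a y = \<gamma>" and bc: "(b, c) \<in> composable G" "cmp G b c = y"
      using t by (auto simp: t_eq factorizations_def)
    have ab: "(a, b) \<in> composable G"
      using ay(1) bc rng_cmp[OF bc(1)] by (auto simp: composable_def)
    have "(cmp G a b, c) \<in> composable G"
      using ab bc(1) src_cmp[OF ab] cmp_closed[OF ab] by (auto simp: composable_def)
    with cmp_assoc[OF ab bc(1)] ab bc ay show ?thesis by (simp add: t_eq factorizations_def)
  qed
  show ?thesis
    by (rule bij_betw_byWitness[where f' = ?k]) (use L R in blast)+
qed

context R_bundle
begin

sublocale total: semigroupoid "total B" by (rule semigroupoid_total)
sublocale base: semigroupoid "base B" by (rule semigroupoid_base)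

lemma fibre_group: "\<gamma> \<in> arr (base B) \<Longrightarrow> comm_group (fibre_group B \<gamma>)"
  using bimodule.additive_group[OF fibre_bimodule] .

lemma fibre_monoid: "\<gamma> \<in> arr (base B) \<Longrightarrow> comm_monoid (fibre_group B \<gamma>)"
  using fibre_group comm_group.axioms(1) by blast

lemma fzero_in_fibre: "\<gamma> \<in> arr (base B) \<Longrightarrow> fzero B \<gamma> \<in> fibre B \<gamma>"
  using bimodule_zero_and_inverse(1)[OF fibre_bimodule] .

lemma fadd_in_fibre:
  "\<lbrakk>\<gamma> \<in> arr (base B); x \<in> fibre B \<gamma>; y \<in> fibre B \<gamma>\<rbrakk> \<Longrightarrow> fadd B x y \<in> fibre B \<gamma>"
  using monoid.m_closed[OF comm_monoid.axioms(1)[OF fibre_monoid], of \<gamma> x y] by simp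

lemma composable_arr:
  "(\<gamma>, \<delta>) \<in> composable (base B) \<Longrightarrow> \<gamma> \<in> arr (base B)"
  "(\<gamma>, \<delta>) \<in> composable (base B) \<Longrightarrow> \<delta> \<in> arr (base B)"
  by (auto simp: composable_def)

lemma fibres_composable:
  assumes "(\<gamma>, \<delta>) \<in> composable (base B)" "x \<in> fibre B \<gamma>" "y \<in> fibre B \<delta>"
  shows "(x, y) \<in> composable (total B)"
  using rigid_proj assms unfolding rigid_semigroupoid_hom_def fibre_def by auto

lemma cmp_in_fibre:
  assumes "(\<gamma>, \<delta>) \<in> composable (base B)" "x \<in> fibre B \<gamma>" "y \<in> fibre B \<delta>"
  shows "cmp (total B) x y \<in> fibre B (cmp (base B) \<gamma> \<delta>)"
proof -
  have xy: "(x, y) \<in> composable (total B)" using assms by (rule fibres_composable)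
  then have "proj B (cmp (total B) x y) = cmp (base B) (proj B x) (proj B y)"
    using rigid_proj unfolding rigid_semigroupoid_hom_def semigroupoid_hom_def by auto
  with total.cmp_closed[OF xy] assms(2,3) show ?thesis by (simp add: fibre_def)
qed

lemma cmp_zero:
  assumes c: "(\<gamma>, \<delta>) \<in> composable (base B)"
  shows "y \<in> fibre B \<delta> \<Longrightarrow> cmp (total B) (fzero B \<gamma>) y = fzero B (cmp (base B) \<gamma> \<delta>)"
    and "x \<in> fibre B \<gamma> \<Longrightarrow> cmp (total B) x (fzero B \<delta>) = fzero B (cmp (base B) \<gamma> \<delta>)"
proof -
  note \<gamma> = composable_arr(1)[OF c] and \<delta> = composable_arr(2)[OF c]
  interpret G: comm_group "fibre_group B (cmp (base B) \<gamma> \<delta>)"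
    by (rule fibre_group[OF base.cmp_closed[OF c]])
  have idem: "x = fzero B (cmp (base B) \<gamma> \<delta>)"
    if "x \<in> fibre B (cmp (base B) \<gamma> \<delta>)" "fadd B x x = x" for x
    using G.l_cancel_one[of x x] that by simp
  note zz = bimodule_zero_and_inverse(4)[OF fibre_bimodule fzero_in_fibre]
  show "cmp (total B) (fzero B \<gamma>) y = fzero B (cmp (base B) \<gamma> \<delta>)" if y: "y \<in> fibre B \<delta>"
    using fibre_add_prd[OF c fzero_in_fibre[OF \<gamma>] fzero_in_fibre[OF \<gamma>] y] zz[OF \<gamma> \<gamma>]
    by (intro idem cmp_in_fibre[OF c fzero_in_fibre[OF \<gamma>] y]) simp
  show "cmp (total B) x (fzero B \<delta>) = fzero B (cmp (base B) \<gamma> \<delta>)" if x: "x \<in> fibre B \<gamma>"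
    using fibre_prd_add[OF c x fzero_in_fibre[OF \<delta>] fzero_in_fibre[OF \<delta>]] zz[OF \<delta> \<delta>]
    by (intro idem cmp_in_fibre[OF c x fzero_in_fibre[OF \<delta>]]) simp
qed

lemma finprod_cmp:
  assumes c: "(\<gamma>, \<delta>) \<in> composable (base B)" and f: "f \<in> I \<rightarrow> fibre B \<gamma>" and y: "y \<in> fibre B \<delta>"
  shows "cmp (total B) (finprod (fibre_group B \<gamma>) f I) y
    = finprod (fibre_group B (cmp (base B) \<gamma> \<delta>)) (\<lambda>i. cmp (total B) (f i) y) I"
  by (rule finprod_hom[where h = "\<lambda>x. cmp (total B) x y"])
    (use c f y fibre_monoid[OF composable_arr(1)[OF c]] fibre_monoid[OF base.cmp_closed[OF c]]
      in \<open>auto simp: cmp_in_fibre cmp_zero fibre_add_prd\<close>)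

lemma cmp_finprod:
  assumes c: "(\<gamma>, \<delta>) \<in> composable (base B)" and f: "f \<in> I \<rightarrow> fibre B \<delta>" and x: "x \<in> fibre B \<gamma>"
  shows "cmp (total B) x (finprod (fibre_group B \<delta>) f I)
    = finprod (fibre_group B (cmp (base B) \<gamma> \<delta>)) (\<lambda>i. cmp (total B) x (f i)) I"
  by (rule finprod_hom[where h = "cmp (total B) x"])
    (use c f x fibre_monoid[OF composable_arr(2)[OF c]] fibre_monoid[OF base.cmp_closed[OF c]]
      in \<open>auto simp: cmp_in_fibre cmp_zero fibre_prd_add\<close>)

lemma finprod_lsc:
  assumes \<gamma>: "\<gamma> \<in> arr (base B)" and f: "f \<in> I \<rightarrow> fibre B \<gamma>"
  shows "flsc B r (finprod (fibre_group B \<gamma>) f I) = finprod (fibre_group B \<gamma>) (\<lambda>i. flsc B r (f i)) I"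
proof -
  interpret bimodule "fibre B \<gamma>" "fadd B" "fzero B \<gamma>" "flsc B" "frsc B" by (rule fibre_bimodule[OF \<gamma>])
  show ?thesis
    by (rule finprod_hom)
      (use fibre_monoid[OF \<gamma>] f bimodule_zero_and_inverse(2)[OF fibre_bimodule[OF \<gamma>]]
        in \<open>auto simp: lsc_closed lsc_add\<close>)
qed

lemma finprod_rsc:
  assumes \<gamma>: "\<gamma> \<in> arr (base B)" and f: "f \<in> I \<rightarrow> fibre B \<gamma>"
  shows "frsc B (finprod (fibre_group B \<gamma>) f I) r = finprod (fibre_group B \<gamma>) (\<lambda>i. frsc B (f i) r) I"
proof -
  interpret bimodule "fibre B \<gamma>" "fadd B" "fzero B \<gamma>" "flsc B" "frsc B" by (rule fibre_bimodule[OF \<gamma>])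
  show ?thesis
    by (rule finprod_hom[where h = "\<lambda>x. frsc B x r"])
      (use fibre_monoid[OF \<gamma>] f bimodule_zero_and_inverse(3)[OF fibre_bimodule[OF \<gamma>]]
        in \<open>auto simp: rsc_closed rsc_add\<close>)
qed

section \<open>Sections\<close>

lemma section_in_fibre: "\<lbrakk>\<alpha> \<in> sections B; \<gamma> \<in> arr (base B)\<rbrakk> \<Longrightarrow> \<alpha> \<gamma> \<in> fibre B \<gamma>"
  by (auto simp: sections_def)

lemma section_eqI:
  assumes "\<alpha> \<in> sections B" "\<beta> \<in> sections B"
    and "\<And>\<gamma>. \<gamma> \<in> arr (base B) \<Longrightarrow> \<alpha> \<gamma> = \<beta> \<gamma>"
  shows "\<alpha> = \<beta>"
  using assms unfolding sections_def by (rule PiE_ext)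

lemma sec_zero_section: "sec_zero B \<in> sections B"
  by (auto simp: sec_zero_def sections_def fzero_in_fibre)

lemma sec_add_section: "\<lbrakk>\<alpha> \<in> sections B; \<beta> \<in> sections B\<rbrakk> \<Longrightarrow> sec_add B \<alpha> \<beta> \<in> sections B"
  by (auto simp: sec_add_def sections_def intro!: fadd_in_fibre)

lemma sec_lsc_section: "\<alpha> \<in> sections B \<Longrightarrow> sec_lsc B r \<alpha> \<in> sections B"
  by (auto simp: sec_lsc_def sections_def intro!: bimodule.lsc_closed[OF fibre_bimodule])

lemma sec_rsc_section: "\<alpha> \<in> sections B \<Longrightarrow> sec_rsc B \<alpha> r \<in> sections B"
  by (auto simp: sec_rsc_def sections_def intro!: bimodule.rsc_closed[OF fibre_bimodule])

lemmas section_simps = sec_zero_section sec_add_section sec_lsc_section sec_rsc_section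

lemma bimodule_of_sections:
  assumes M: "M \<subseteq> sections B"
    and zero: "sec_zero B \<in> M"
    and add: "\<And>\<alpha> \<beta>. \<lbrakk>\<alpha> \<in> M; \<beta> \<in> M\<rbrakk> \<Longrightarrow> sec_add B \<alpha> \<beta> \<in> M"
    and lsc: "\<And>r \<alpha>. \<alpha> \<in> M \<Longrightarrow> sec_lsc B r \<alpha> \<in> M"
    and rsc: "\<And>r \<alpha>. \<alpha> \<in> M \<Longrightarrow> sec_rsc B \<alpha> r \<in> M"
  shows "bimodule M (sec_add B) (sec_zero B) (sec_lsc B) (sec_rsc B)"
proof -
  have Ms: "\<alpha> \<in> sections B" if "\<alpha> \<in> M" for \<alpha> using M that by blast
  note fb = section_in_fibre[OF Ms]
  note bim = fibre_bimodule
  have fassoc: "fadd B (fadd B x y) z = fadd B x (fadd B y z)"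
    if "\<gamma> \<in> arr (base B)" "x \<in> fibre B \<gamma>" "y \<in> fibre B \<gamma>" "z \<in> fibre B \<gamma>" for \<gamma> x y z
    using monoid.m_assoc[OF comm_monoid.axioms(1)[OF fibre_monoid[OF that(1)]], of x y z] that by simp
  have fcomm: "fadd B x y = fadd B y x"
    if "\<gamma> \<in> arr (base B)" "x \<in> fibre B \<gamma>" "y \<in> fibre B \<gamma>" for \<gamma> x y
    using comm_monoid.m_comm[OF fibre_monoid[OF that(1)], of x y] that by simp
  have pt: "sec_zero B \<gamma> = fzero B \<gamma>" "sec_add B \<alpha> \<beta> \<gamma> = fadd B (\<alpha> \<gamma>) (\<beta> \<gamma>)"
    "sec_lsc B r \<alpha> \<gamma> = flsc B r (\<alpha> \<gamma>)" "sec_rsc B \<alpha> r \<gamma> = frsc B (\<alpha> \<gamma>) r"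
    if "\<gamma> \<in> arr (base B)" for \<alpha> \<beta> \<gamma> r
    using that by (simp_all add: sec_zero_def sec_add_def sec_lsc_def sec_rsc_def)
  have grp: "comm_group (add_group M (sec_add B) (sec_zero B))"
  proof (rule comm_groupI; simp)
    fix \<alpha> \<beta> \<delta> assume ab: "\<alpha> \<in> M" "\<beta> \<in> M"
    show "sec_add B \<alpha> \<beta> \<in> M" using ab by (rule add)
    show "sec_add B \<alpha> \<beta> = sec_add B \<beta> \<alpha>"
      by (rule section_eqI) (use ab fcomm fb in \<open>auto simp: section_simps Ms pt\<close>)
    show "sec_add B (sec_add B \<alpha> \<beta>) \<delta> = sec_add B \<alpha> (sec_add B \<beta> \<delta>)" if "\<delta> \<in> M"
      by (rule section_eqI) (use ab that fassoc fb in \<open>auto simp: section_simps Ms pt\<close>)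
  next
    show "sec_zero B \<in> M" by (rule zero)
    fix \<alpha> assume a: "\<alpha> \<in> M"
    show "sec_add B (sec_zero B) \<alpha> = \<alpha>"
      by (rule section_eqI) (use a in \<open>auto simp: section_simps Ms pt bimodule_zero_and_inverse(4)[OF bim fb]\<close>)
    have "sec_add B (sec_lsc B (- 1) \<alpha>) \<alpha> = sec_zero B"
      by (rule section_eqI) (use a in \<open>auto simp: section_simps Ms pt bimodule_zero_and_inverse(5)[OF bim fb]\<close>)
    with lsc[OF a] show "\<exists>\<beta>\<in>M. sec_add B \<beta> \<alpha> = sec_zero B" by blast
  qed
  show ?thesis
    by (rule bimodule.intro; (rule grp lsc rsc | (rule section_eqI,
        auto simp: section_simps Ms pt
          bimodule.lsc_add[OF bim fb fb] bimodule.add_lsc[OF bim fb] bimodule.mult_lsc[OF bim fb]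
          bimodule.one_lsc[OF bim fb] bimodule.rsc_add[OF bim fb fb] bimodule.add_rsc[OF bim fb]
          bimodule.mult_rsc[OF bim fb] bimodule.one_rsc[OF bim fb] bimodule.lsc_rsc[OF bim fb])))
qed

end

section \<open>The convolution algebra\<close>

locale finitely_factorizing_bundle = R_bundle B
  for B :: "('r::{ring,monoid_mult}, 'l, 'w, 'g, 'v) fibred_bimodules" +
  assumes finite_factorizations: "\<gamma> \<in> arr (base B) \<Longrightarrow> finite (factorizations (base B) \<gamma>)"
begin

abbreviation summand :: "('g \<Rightarrow> 'l) \<Rightarrow> ('g \<Rightarrow> 'l) \<Rightarrow> 'g \<times> 'g \<Rightarrow> 'l" where
  "summand \<alpha> \<beta> p \<equiv> cmp (total B) (\<alpha> (fst p)) (\<beta> (snd p))"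

lemma factorizationsD:
  assumes "p \<in> factorizations (base B) \<gamma>"
  shows "(fst p, snd p) \<in> composable (base B)" "cmp (base B) (fst p) (snd p) = \<gamma>"
    "fst p \<in> arr (base B)" "snd p \<in> arr (base B)"
  using assms by (auto simp: factorizations_def composable_def)

lemma summand_in_fibre:
  assumes "\<alpha> \<in> sections B" "\<beta> \<in> sections B" "p \<in> factorizations (base B) \<gamma>"
  shows "summand \<alpha> \<beta> p \<in> fibre B \<gamma>"
  using cmp_in_fibre[OF factorizationsD(1)[OF assms(3)]
      section_in_fibre[OF assms(1) factorizationsD(3)[OF assms(3)]]
      section_in_fibre[OF assms(2) factorizationsD(4)[OF assms(3)]]]
    factorizationsD(2)[OF assms(3)] by simp

text \<open>
  The index set on the right is the same for all pairs of sections, so additivity, scalar laws and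
  continuity can be checked term by term.
\<close>

lemma sec_conv_eq:
  assumes "\<alpha> \<in> sections B" "\<beta> \<in> sections B" and \<gamma>: "\<gamma> \<in> arr (base B)"
  shows "sec_conv B \<alpha> \<beta> \<gamma> = finprod (fibre_group B \<gamma>) (summand \<alpha> \<beta>) (factorizations (base B) \<gamma>)"
proof -
  interpret G: comm_monoid "fibre_group B \<gamma>" by (rule fibre_monoid[OF \<gamma>])
  have "sec_conv B \<alpha> \<beta> \<gamma> = finprod (fibre_group B \<gamma>) (summand \<alpha> \<beta>)
      {(a, b) \<in> composable (base B).
        cmp (base B) a b = \<gamma> \<and> cmp (total B) (\<alpha> a) (\<beta> b) \<noteq> fzero B \<gamma>}"
    using \<gamma> by (simp add: sec_conv_def case_prod_unfold)
  also have "\<dots> = finprod (fibre_group B \<gamma>) (summand \<alpha> \<beta>) (factorizations (base B) \<gamma>)"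
    by (rule G.finprod_mono_neutral_cong_left)
      (use assms finite_factorizations summand_in_fibre in \<open>auto simp: factorizations_def\<close>)
  finally show ?thesis .
qed

lemma sec_conv_section:
  assumes "\<alpha> \<in> sections B" "\<beta> \<in> sections B"
  shows "sec_conv B \<alpha> \<beta> \<in> sections B"
proof -
  have "sec_conv B \<alpha> \<beta> \<gamma> \<in> fibre B \<gamma>" if \<gamma>: "\<gamma> \<in> arr (base B)" for \<gamma>
  proof -
    interpret G: comm_monoid "fibre_group B \<gamma>" by (rule fibre_monoid[OF \<gamma>])
    show ?thesis
      using G.finprod_closed[of "summand \<alpha> \<beta>" "factorizations (base B) \<gamma>"]
        summand_in_fibre[OF assms] by (simp add: sec_conv_eq[OF assms \<gamma>])
  qed
  then show ?thesis by (auto simp: sections_def sec_conv_def)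
qed

lemma sec_conv_eqI:
  assumes s: "\<alpha> \<in> sections B" "\<beta> \<in> sections B" "\<alpha>' \<in> sections B" "\<beta>' \<in> sections B"
    and "\<And>\<gamma> p. \<lbrakk>\<gamma> \<in> arr (base B); p \<in> factorizations (base B) \<gamma>\<rbrakk> \<Longrightarrow> summand \<alpha> \<beta> p = summand \<alpha>' \<beta>' p"
  shows "sec_conv B \<alpha> \<beta> = sec_conv B \<alpha>' \<beta>'"
proof (rule section_eqI)
  fix \<gamma> assume \<gamma>: "\<gamma> \<in> arr (base B)"
  interpret G: comm_monoid "fibre_group B \<gamma>" by (rule fibre_monoid[OF \<gamma>])
  show "sec_conv B \<alpha> \<beta> \<gamma> = sec_conv B \<alpha>' \<beta>' \<gamma>"
    unfolding sec_conv_eq[OF s(1,2) \<gamma>] sec_conv_eq[OF s(3,4) \<gamma>]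
    by (rule G.finprod_cong') (use assms(5)[OF \<gamma>] summand_in_fibre[OF s(3,4)] in auto)
qed (simp_all add: sec_conv_section s)

text \<open>
  Fubini: each bracketing becomes a single sum over refined factorizations, and the two index sets
  are matched by the reassociation bijection, under which the summands agree because
  the product of the total space is associative.
\<close>

lemma sec_conv_assoc:
  assumes s: "\<alpha> \<in> sections B" "\<beta> \<in> sections B" "\<delta> \<in> sections B"
  shows "sec_conv B (sec_conv B \<alpha> \<beta>) \<delta> = sec_conv B \<alpha> (sec_conv B \<beta> \<delta>)"
proof (rule section_eqI)
  fix \<gamma> assume \<gamma>: "\<gamma> \<in> arr (base B)"
  interpret G: comm_monoid "fibre_group B \<gamma>" by (rule fibre_monoid[OF \<gamma>])
  let ?F = "factorizations (base B)"
  let ?S = "fibre_group B \<gamma>"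
  let ?c = "cmp (total B)"
  have fin: "finite (?F \<gamma>)" "\<And>p. p \<in> ?F \<gamma> \<Longrightarrow> finite (?F (fst p)) \<and> finite (?F (snd p))"
    using \<gamma> finite_factorizations factorizationsD(3,4) by blast+
  note ab = sec_conv_section[OF s(1,2)] and bd = sec_conv_section[OF s(2,3)]
  let ?l = "\<lambda>t. ?c (summand \<alpha> \<beta> (snd t)) (\<delta> (snd (fst t)))"
  let ?r = "\<lambda>t. ?c (\<alpha> (fst (fst t))) (summand \<beta> \<delta> (snd t))"
  let ?L = "SIGMA p:?F \<gamma>. ?F (fst p)"
  let ?R = "SIGMA p:?F \<gamma>. ?F (snd p)"
  let ?h = "\<lambda>((x, c), (a, b)). ((a, cmp (base B) b c), (b, c))"
  have h: "bij_betw ?h ?L ?R" by (rule base.bij_betw_triple_factorizations)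
  have l_in: "?l (p, q) \<in> fibre B \<gamma>" if "p \<in> ?F \<gamma>" "q \<in> ?F (fst p)" for p q
    using cmp_in_fibre[OF factorizationsD(1)[OF that(1)] summand_in_fibre[OF s(1,2) that(2)]
        section_in_fibre[OF s(3) factorizationsD(4)[OF that(1)]]]
      factorizationsD(2)[OF that(1)] by simp
  have r_in: "?r (p, q) \<in> fibre B \<gamma>" if "p \<in> ?F \<gamma>" "q \<in> ?F (snd p)" for p q
    using cmp_in_fibre[OF factorizationsD(1)[OF that(1)]
        section_in_fibre[OF s(1) factorizationsD(3)[OF that(1)]] summand_in_fibre[OF s(2,3) that(2)]]
      factorizationsD(2)[OF that(1)] by simp
  have r_in': "?r t \<in> fibre B \<gamma>" if "t \<in> ?R" for t
    using that r_in[of "fst t" "snd t"] by (cases t) simp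
  have "sec_conv B (sec_conv B \<alpha> \<beta>) \<delta> \<gamma> = finprod ?S (\<lambda>p. finprod ?S (\<lambda>q. ?l (p, q)) (?F (fst p))) (?F \<gamma>)"
    unfolding sec_conv_eq[OF ab s(3) \<gamma>]
  proof (rule G.finprod_cong'[OF refl])
    show "(\<lambda>p. finprod ?S (\<lambda>q. ?l (p, q)) (?F (fst p))) \<in> ?F \<gamma> \<rightarrow> carrier ?S"
      by (intro Pi_I G.finprod_closed) (use l_in in auto)
    fix p assume p: "p \<in> ?F \<gamma>"
    have in_fst: "summand \<alpha> \<beta> \<in> ?F (fst p) \<rightarrow> fibre B (fst p)"
      using summand_in_fibre[OF s(1,2)] by blast
    show "summand (sec_conv B \<alpha> \<beta>) \<delta> p = finprod ?S (\<lambda>q. ?l (p, q)) (?F (fst p))"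
      unfolding sec_conv_eq[OF s(1,2) factorizationsD(3)[OF p]]
      using finprod_cmp[OF factorizationsD(1)[OF p] in_fst section_in_fibre[OF s(3) factorizationsD(4)[OF p]]]
        factorizationsD(2)[OF p] by simp
  qed
  also have "\<dots> = finprod ?S ?l ?L"
    by (rule G.finprod_Sigma) (use fin l_in in auto)
  also have "\<dots> = finprod ?S (\<lambda>t. ?r (?h t)) ?L"
  proof (rule G.finprod_cong'[OF refl])
    show "(\<lambda>t. ?r (?h t)) \<in> ?L \<rightarrow> carrier ?S"
      unfolding partial_object.select_convs by (intro Pi_I r_in' bij_betw_apply[OF h])
    fix t assume t: "t \<in> ?L"
    obtain x c a b where t_eq: "t = ((x, c), (a, b))" by (cases t) force
    have "?h t \<in> ?R" using bij_betw_apply[OF h t] .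
    then have bc: "(b, c) \<in> composable (base B)" by (auto simp: t_eq factorizations_def)
    have ab: "(a, b) \<in> composable (base B)" using t by (auto simp: t_eq factorizations_def)
    note fib = section_in_fibre[OF s(1) composable_arr(1)[OF ab]]
      section_in_fibre[OF s(2) composable_arr(1)[OF bc]] section_in_fibre[OF s(3) composable_arr(2)[OF bc]]
    show "?l t = ?r (?h t)"
      using total.cmp_assoc[OF fibres_composable[OF ab fib(1,2)] fibres_composable[OF bc fib(2,3)]]
      by (simp add: t_eq)
  qed
  also have "\<dots> = finprod ?S ?r (?h ` ?L)"
  proof (rule G.finprod_reindex[symmetric])
    show "?r \<in> ?h ` ?L \<rightarrow> carrier ?S"
      unfolding bij_betw_imp_surj_on[OF h] partial_object.select_convs by (intro Pi_I r_in')
    show "inj_on ?h ?L" using h by (rule bij_betw_imp_inj_on)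
  qed
  also have "\<dots> = finprod ?S ?r ?R" by (simp only: bij_betw_imp_surj_on[OF h])
  also have "\<dots> = finprod ?S (\<lambda>p. finprod ?S (\<lambda>q. ?r (p, q)) (?F (snd p))) (?F \<gamma>)"
    by (rule G.finprod_Sigma[symmetric]) (use fin r_in in auto)
  also have "\<dots> = sec_conv B \<alpha> (sec_conv B \<beta> \<delta>) \<gamma>"
    unfolding sec_conv_eq[OF s(1) bd \<gamma>]
  proof (rule G.finprod_cong'[OF refl])
    show "summand \<alpha> (sec_conv B \<beta> \<delta>) \<in> ?F \<gamma> \<rightarrow> carrier ?S"
      using summand_in_fibre[OF s(1) bd] by auto
    fix p assume p: "p \<in> ?F \<gamma>"
    have in_snd: "summand \<beta> \<delta> \<in> ?F (snd p) \<rightarrow> fibre B (snd p)"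
      using summand_in_fibre[OF s(2,3)] by blast
    show "finprod ?S (\<lambda>q. ?r (p, q)) (?F (snd p)) = summand \<alpha> (sec_conv B \<beta> \<delta>) p"
      unfolding sec_conv_eq[OF s(2,3) factorizationsD(4)[OF p]]
      using cmp_finprod[OF factorizationsD(1)[OF p] in_snd section_in_fibre[OF s(1) factorizationsD(3)[OF p]]]
        factorizationsD(2)[OF p] by simp
  qed
  finally show "sec_conv B (sec_conv B \<alpha> \<beta>) \<delta> \<gamma> = sec_conv B \<alpha> (sec_conv B \<beta> \<delta>) \<gamma>" .
qed (simp_all add: sec_conv_section s)

lemma sec_conv_add_left:
  assumes s: "\<alpha> \<in> sections B" "\<alpha>' \<in> sections B" "\<beta> \<in> sections B"
  shows "sec_conv B (sec_add B \<alpha> \<alpha>') \<beta> = sec_add B (sec_conv B \<alpha> \<beta>) (sec_conv B \<alpha>' \<beta>)"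
proof (rule section_eqI)
  fix \<gamma> assume \<gamma>: "\<gamma> \<in> arr (base B)"
  interpret G: comm_monoid "fibre_group B \<gamma>" by (rule fibre_monoid[OF \<gamma>])
  have eq: "summand (sec_add B \<alpha> \<alpha>') \<beta> p = fadd B (summand \<alpha> \<beta> p) (summand \<alpha>' \<beta> p)"
    if p: "p \<in> factorizations (base B) \<gamma>" for p
    using fibre_add_prd[OF factorizationsD(1)[OF p] section_in_fibre[OF s(1) factorizationsD(3)[OF p]]
        section_in_fibre[OF s(2) factorizationsD(3)[OF p]] section_in_fibre[OF s(3) factorizationsD(4)[OF p]]]
      factorizationsD(3)[OF p] by (simp add: sec_add_def)
  have "sec_conv B (sec_add B \<alpha> \<alpha>') \<beta> \<gamma> = finprod (fibre_group B \<gamma>)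
      (\<lambda>p. fadd B (summand \<alpha> \<beta> p) (summand \<alpha>' \<beta> p)) (factorizations (base B) \<gamma>)"
    unfolding sec_conv_eq[OF sec_add_section[OF s(1,2)] s(3) \<gamma>]
    by (rule G.finprod_cong') (use eq fadd_in_fibre[OF \<gamma>] summand_in_fibre s in auto)
  also have "\<dots> = fadd B (sec_conv B \<alpha> \<beta> \<gamma>) (sec_conv B \<alpha>' \<beta> \<gamma>)"
    unfolding sec_conv_eq[OF s(1,3) \<gamma>] sec_conv_eq[OF s(2,3) \<gamma>]
    using G.finprod_multf[of "summand \<alpha> \<beta>" _ "summand \<alpha>' \<beta>"] summand_in_fibre s by simp
  finally show "sec_conv B (sec_add B \<alpha> \<alpha>') \<beta> \<gamma> = sec_add B (sec_conv B \<alpha> \<beta>) (sec_conv B \<alpha>' \<beta>) \<gamma>"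
    using \<gamma> by (simp add: sec_add_def)
qed (simp_all add: sec_conv_section sec_add_section s)

lemma sec_conv_add_right:
  assumes s: "\<alpha> \<in> sections B" "\<beta> \<in> sections B" "\<beta>' \<in> sections B"
  shows "sec_conv B \<alpha> (sec_add B \<beta> \<beta>') = sec_add B (sec_conv B \<alpha> \<beta>) (sec_conv B \<alpha> \<beta>')"
proof (rule section_eqI)
  fix \<gamma> assume \<gamma>: "\<gamma> \<in> arr (base B)"
  interpret G: comm_monoid "fibre_group B \<gamma>" by (rule fibre_monoid[OF \<gamma>])
  have eq: "summand \<alpha> (sec_add B \<beta> \<beta>') p = fadd B (summand \<alpha> \<beta> p) (summand \<alpha> \<beta>' p)"
    if p: "p \<in> factorizations (base B) \<gamma>" for p
    using fibre_prd_add[OF factorizationsD(1)[OF p] section_in_fibre[OF s(1) factorizationsD(3)[OF p]]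
        section_in_fibre[OF s(2) factorizationsD(4)[OF p]] section_in_fibre[OF s(3) factorizationsD(4)[OF p]]]
      factorizationsD(4)[OF p] by (simp add: sec_add_def)
  have "sec_conv B \<alpha> (sec_add B \<beta> \<beta>') \<gamma> = finprod (fibre_group B \<gamma>)
      (\<lambda>p. fadd B (summand \<alpha> \<beta> p) (summand \<alpha> \<beta>' p)) (factorizations (base B) \<gamma>)"
    unfolding sec_conv_eq[OF s(1) sec_add_section[OF s(2,3)] \<gamma>]
    by (rule G.finprod_cong') (use eq fadd_in_fibre[OF \<gamma>] summand_in_fibre s in auto)
  also have "\<dots> = fadd B (sec_conv B \<alpha> \<beta> \<gamma>) (sec_conv B \<alpha> \<beta>' \<gamma>)"
    unfolding sec_conv_eq[OF s(1,2) \<gamma>] sec_conv_eq[OF s(1,3) \<gamma>]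
    using G.finprod_multf[of "summand \<alpha> \<beta>" _ "summand \<alpha> \<beta>'"] summand_in_fibre s by simp
  finally show "sec_conv B \<alpha> (sec_add B \<beta> \<beta>') \<gamma> = sec_add B (sec_conv B \<alpha> \<beta>) (sec_conv B \<alpha> \<beta>') \<gamma>"
    using \<gamma> by (simp add: sec_add_def)
qed (simp_all add: sec_conv_section sec_add_section s)

lemma sec_conv_balanced:
  assumes s: "\<alpha> \<in> sections B" "\<beta> \<in> sections B"
  shows "sec_conv B (sec_rsc B \<alpha> r) \<beta> = sec_conv B \<alpha> (sec_lsc B r \<beta>)"
proof (rule sec_conv_eqI)
  fix \<gamma> p assume p: "p \<in> factorizations (base B) \<gamma>"
  show "summand (sec_rsc B \<alpha> r) \<beta> p = summand \<alpha> (sec_lsc B r \<beta>) p"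
    using fibre_prd_balanced[OF factorizationsD(1)[OF p] section_in_fibre[OF s(1) factorizationsD(3)[OF p]]
        section_in_fibre[OF s(2) factorizationsD(4)[OF p]]] factorizationsD(3,4)[OF p]
    by (simp add: sec_rsc_def sec_lsc_def)
qed (simp_all add: section_simps s)

lemma sec_conv_lsc:
  assumes s: "\<alpha> \<in> sections B" "\<beta> \<in> sections B"
  shows "sec_conv B (sec_lsc B r \<alpha>) \<beta> = sec_lsc B r (sec_conv B \<alpha> \<beta>)"
proof (rule section_eqI)
  fix \<gamma> assume \<gamma>: "\<gamma> \<in> arr (base B)"
  interpret G: comm_monoid "fibre_group B \<gamma>" by (rule fibre_monoid[OF \<gamma>])
  have eq: "summand (sec_lsc B r \<alpha>) \<beta> p = flsc B r (summand \<alpha> \<beta> p)"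
    if p: "p \<in> factorizations (base B) \<gamma>" for p
    using fibre_lsc_prd[OF factorizationsD(1)[OF p] section_in_fibre[OF s(1) factorizationsD(3)[OF p]]
        section_in_fibre[OF s(2) factorizationsD(4)[OF p]]]
      factorizationsD(3)[OF p] by (simp add: sec_lsc_def)
  have "sec_conv B (sec_lsc B r \<alpha>) \<beta> \<gamma> = finprod (fibre_group B \<gamma>)
      (\<lambda>p. flsc B r (summand \<alpha> \<beta> p)) (factorizations (base B) \<gamma>)"
    unfolding sec_conv_eq[OF sec_lsc_section[OF s(1)] s(2) \<gamma>]
    by (rule G.finprod_cong')
      (use eq bimodule.lsc_closed[OF fibre_bimodule[OF \<gamma>]] summand_in_fibre s in auto)
  also have "\<dots> = flsc B r (sec_conv B \<alpha> \<beta> \<gamma>)"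
    unfolding sec_conv_eq[OF s \<gamma>] by (rule finprod_lsc[symmetric, OF \<gamma>]) (use summand_in_fibre s in auto)
  finally show "sec_conv B (sec_lsc B r \<alpha>) \<beta> \<gamma> = sec_lsc B r (sec_conv B \<alpha> \<beta>) \<gamma>"
    using \<gamma> by (simp add: sec_lsc_def)
qed (simp_all add: sec_conv_section sec_lsc_section s)

lemma sec_conv_rsc:
  assumes s: "\<alpha> \<in> sections B" "\<beta> \<in> sections B"
  shows "sec_conv B \<alpha> (sec_rsc B \<beta> r) = sec_rsc B (sec_conv B \<alpha> \<beta>) r"
proof (rule section_eqI)
  fix \<gamma> assume \<gamma>: "\<gamma> \<in> arr (base B)"
  interpret G: comm_monoid "fibre_group B \<gamma>" by (rule fibre_monoid[OF \<gamma>])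
  have eq: "summand \<alpha> (sec_rsc B \<beta> r) p = frsc B (summand \<alpha> \<beta> p) r"
    if p: "p \<in> factorizations (base B) \<gamma>" for p
    using fibre_prd_rsc[OF factorizationsD(1)[OF p] section_in_fibre[OF s(1) factorizationsD(3)[OF p]]
        section_in_fibre[OF s(2) factorizationsD(4)[OF p]]]
      factorizationsD(4)[OF p] by (simp add: sec_rsc_def)
  have "sec_conv B \<alpha> (sec_rsc B \<beta> r) \<gamma> = finprod (fibre_group B \<gamma>)
      (\<lambda>p. frsc B (summand \<alpha> \<beta> p) r) (factorizations (base B) \<gamma>)"
    unfolding sec_conv_eq[OF s(1) sec_rsc_section[OF s(2)] \<gamma>]
    by (rule G.finprod_cong')
      (use eq bimodule.rsc_closed[OF fibre_bimodule[OF \<gamma>]] summand_in_fibre s in auto)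
  also have "\<dots> = frsc B (sec_conv B \<alpha> \<beta> \<gamma>) r"
    unfolding sec_conv_eq[OF s \<gamma>] by (rule finprod_rsc[symmetric, OF \<gamma>]) (use summand_in_fibre s in auto)
  finally show "sec_conv B \<alpha> (sec_rsc B \<beta> r) \<gamma> = sec_rsc B (sec_conv B \<alpha> \<beta>) r \<gamma>"
    using \<gamma> by (simp add: sec_rsc_def)
qed (simp_all add: sec_conv_section sec_rsc_section s)

lemma bimodule_algebra_of_sections:
  assumes M: "M \<subseteq> sections B"
    and "sec_zero B \<in> M"
    and "\<And>\<alpha> \<beta>. \<lbrakk>\<alpha> \<in> M; \<beta> \<in> M\<rbrakk> \<Longrightarrow> sec_add B \<alpha> \<beta> \<in> M"
    and "\<And>r \<alpha>. \<alpha> \<in> M \<Longrightarrow> sec_lsc B r \<alpha> \<in> M"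
    and "\<And>r \<alpha>. \<alpha> \<in> M \<Longrightarrow> sec_rsc B \<alpha> r \<in> M"
    and conv: "\<And>\<alpha> \<beta>. \<lbrakk>\<alpha> \<in> M; \<beta> \<in> M\<rbrakk> \<Longrightarrow> sec_conv B \<alpha> \<beta> \<in> M"
  shows "bimodule_algebra M (sec_add B) (sec_zero B) (sec_lsc B) (sec_rsc B) (sec_conv B)"
proof -
  interpret bimodule M "sec_add B" "sec_zero B" "sec_lsc B" "sec_rsc B"
    by (rule bimodule_of_sections) fact+
  have "\<alpha> \<in> sections B" if "\<alpha> \<in> M" for \<alpha> using M that by blast
  then show ?thesis
    by unfold_locales
      (simp_all add: conv sec_conv_assoc sec_conv_add_left sec_conv_add_right sec_conv_balanced
        sec_conv_lsc sec_conv_rsc)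
qed

end

section \<open>Multiplication in an etale semigroupoid\<close>

context etale_semigroupoid
begin

lemma topspace_composable_top: "topspace (composable_top G) = composable G"
  using topspace_arr by (auto simp: composable_def)

lemma locally_compact_arr: "locally_compact_space (arr_top G)"
proof (rule local_homeomorphic_map_locally_compact[OF local_homeo_src])
  show "src G \<in> topspace (arr_top G) \<rightarrow> topspace (vrt_top G)"
    using continuous_src by (rule continuous_map_funspace)
  show "locally_compact_space (vrt_top G)"
    using locally_compact_vrt Hausdorff_vrt locally_compact_space_neighbourhood_base by blast
qed (rule Hausdorff_vrt)

text \<open>
  It is the equalizer of two continuous maps into the Hausdorff space of vertices.
\<close>

lemma closedin_composable: "closedin (prod_topology (arr_top G) (arr_top G)) (composable G)"
proof -
  have "closedin (prod_topology (arr_top G) (arr_top G))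
      {p \<in> topspace (prod_topology (arr_top G) (arr_top G)). (src G \<circ> fst) p = (rng G \<circ> snd) p}"
    by (rule closedin_continuous_maps_eq[OF Hausdorff_vrt])
      (intro continuous_map_compose[OF continuous_map_fst continuous_src]
        continuous_map_compose[OF continuous_map_snd continuous_rng])+
  moreover have "{p \<in> topspace (prod_topology (arr_top G) (arr_top G)). (src G \<circ> fst) p = (rng G \<circ> snd) p}
      = composable G"
    by (auto simp: composable_def topspace_arr)
  ultimately show ?thesis by simp
qed

text \<open>
  On a box \<open>A \<times> C\<close> the image consists of the arrows in \<open>C\<close> whose range is the source of an arrow in
  \<open>A\<close>; it is open because the source map is open and the range map continuous.
\<close>

lemma open_map_snd_composable: "open_map (composable_top G) (arr_top G) snd"
  unfolding open_map_def
proof (intro allI impI)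
  fix N assume "openin (composable_top G) N"
  then obtain W where W: "openin (prod_topology (arr_top G) (arr_top G)) W" and N: "N = W \<inter> composable G"
    by (auto simp: openin_subtopology)
  show "openin (arr_top G) (snd ` N)"
  proof (subst openin_subopen, intro ballI)
    fix b assume "b \<in> snd ` N"
    then obtain a where ab: "(a, b) \<in> W" "(a, b) \<in> composable G" unfolding N by force
    obtain A C where AC: "openin (arr_top G) A" "openin (arr_top G) C" "a \<in> A" "b \<in> C" "A \<times> C \<subseteq> W"
      using W ab(1) unfolding openin_prod_topology_alt by metis
    let ?U = "C \<inter> {b \<in> topspace (arr_top G). rng G b \<in> src G ` A}"
    have "openin (vrt_top G) (src G ` A)"
      using local_homeomorphic_map_open_map[OF local_homeo_src] AC(1) unfolding open_map_def by blast
    then have "openin (arr_top G) ?U"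
      using AC(2) openin_continuous_map_preimage[OF continuous_rng] by blast
    moreover have "b \<in> ?U"
      using ab(2) AC(3,4) topspace_arr imageI[OF AC(3), of "src G"] by (auto simp: composable_def)
    moreover have "?U \<subseteq> snd ` N"
    proof
      fix y assume "y \<in> ?U"
      then obtain x where x: "x \<in> A" "src G x = rng G y" "y \<in> C" "y \<in> arr G"
        using topspace_arr by auto
      then have "(x, y) \<in> N"
        using AC(5) openin_subset[OF AC(1)] topspace_arr by (auto simp: N composable_def)
      then show "y \<in> snd ` N" by force
    qed
    ultimately show "\<exists>T. openin (arr_top G) T \<and> b \<in> T \<and> T \<subseteq> snd ` N" by blast
  qed
qed

text \<open>
  The composite of the multiplication with the source map is \<open>(a, b) \<mapsto> s(b)\<close>, which is open.  Near
  \<open>ab\<close> the source map is injective, so a small image under the multiplication can be recovered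
  from its open image under that composite.
\<close>

lemma open_map_cmp: "open_map (composable_top G) (arr_top G) (\<lambda>(a, b). cmp G a b)"
  unfolding open_map_def
proof (intro allI impI)
  let ?\<mu> = "\<lambda>(a, b). cmp G a b"
  fix N assume N: "openin (composable_top G) N"
  have Nsub: "N \<subseteq> composable G" using openin_subset[OF N] topspace_composable_top by simp
  show "openin (arr_top G) (?\<mu> ` N)"
  proof (subst openin_subopen, intro ballI)
    fix c assume "c \<in> ?\<mu> ` N"
    then obtain p where p: "p \<in> N" "c = ?\<mu> p" by blast
    have "?\<mu> p \<in> arr G" using p(1) Nsub cmp_closed by (cases p) auto
    then obtain U where U: "openin (arr_top G) U" "c \<in> U" "inj_on (src G) U"
      using local_homeomorphic_map_locally_injective[OF local_homeo_src] topspace_arr p(2) by metis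
    let ?N = "N \<inter> {q \<in> topspace (composable_top G). ?\<mu> q \<in> U}"
    have oN: "openin (composable_top G) ?N"
      using N openin_continuous_map_preimage[OF continuous_cmp U(1)] by (rule openin_Int)
    have "openin (vrt_top G) (src G ` snd ` ?N)"
      using open_map_snd_composable local_homeomorphic_map_open_map[OF local_homeo_src] oN
      unfolding open_map_def by blast
    then have "openin (arr_top G) (U \<inter> {c \<in> topspace (arr_top G). src G c \<in> src G ` snd ` ?N})"
      using U(1) openin_continuous_map_preimage[OF continuous_src] by blast
    moreover have "c \<in> U \<inter> {c \<in> topspace (arr_top G). src G c \<in> src G ` snd ` ?N}"
    proof -
      have "p \<in> ?N" using p U(2) Nsub topspace_composable_top by auto
      moreover have "src G c = src G (snd p)"
        using p Nsub src_cmp by (cases p) auto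
      ultimately have "src G c \<in> src G ` snd ` ?N" by blast
      then show ?thesis using U(1,2) openin_subset by blast
    qed
    moreover have "U \<inter> {c \<in> topspace (arr_top G). src G c \<in> src G ` snd ` ?N} \<subseteq> ?\<mu> ` N"
    proof
      fix d assume d: "d \<in> U \<inter> {c \<in> topspace (arr_top G). src G c \<in> src G ` snd ` ?N}"
      then obtain q where q: "q \<in> N" "?\<mu> q \<in> U" "src G d = src G (snd q)" by blast
      have "src G (?\<mu> q) = src G (snd q)" using q(1) Nsub src_cmp by (cases q) auto
      then have "d = ?\<mu> q" using inj_onD[OF U(3)] d q(2,3) by auto
      then show "d \<in> ?\<mu> ` N" using q(1) by blast
    qed
    ultimately show "\<exists>T. openin (arr_top G) T \<and> c \<in> T \<and> T \<subseteq> ?\<mu> ` N" by blast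
  qed
qed

text \<open>
  The product \<open>ab\<close> determines the range of \<open>a\<close> and the source of \<open>b\<close>, and these determine \<open>a\<close> and
  \<open>b\<close> locally.
\<close>

lemma cmp_locally_injective:
  assumes "p \<in> topspace (composable_top G)"
  shows "\<exists>U. openin (composable_top G) U \<and> p \<in> U \<and> inj_on (\<lambda>(a, b). cmp G a b) U"
proof -
  obtain a b where p: "p = (a, b)" and ab: "(a, b) \<in> composable G" "a \<in> topspace (arr_top G)" "b \<in> topspace (arr_top G)"
    using assms topspace_composable_top topspace_arr by (cases p) (auto simp: composable_def)
  obtain U where U: "openin (arr_top G) U" "a \<in> U" "inj_on (rng G) U"
    using local_homeomorphic_map_locally_injective[OF local_homeo_rng ab(2)] by blast
  obtain V where V: "openin (arr_top G) V" "b \<in> V" "inj_on (src G) V"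
    using local_homeomorphic_map_locally_injective[OF local_homeo_src ab(3)] by blast
  let ?N = "(U \<times> V) \<inter> composable G"
  have "openin (composable_top G) ?N"
    using U(1) V(1) by (intro openin_subtopology_Int) (simp add: openin_prod_Times_iff)
  moreover have "p \<in> ?N" using p ab(1) U(2) V(2) by blast
  moreover have "inj_on (\<lambda>(a, b). cmp G a b) ?N"
  proof (rule inj_onI)
    fix q q' assume q: "q \<in> ?N" "q' \<in> ?N" "(case q of (a, b) \<Rightarrow> cmp G a b) = (case q' of (a, b) \<Rightarrow> cmp G a b)"
    obtain x y x' y' where eq: "q = (x, y)" "q' = (x', y')" by (cases q, cases q')
    have "rng G x = rng G x'" "src G y = src G y'"
      using q rng_cmp[of x y] rng_cmp[of x' y'] src_cmp[of x y] src_cmp[of x' y'] unfolding eq by auto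
    then show "q = q'"
      using q inj_onD[OF U(3), of x x'] inj_onD[OF V(3), of y y'] unfolding eq by auto
  qed
  ultimately show ?thesis by blast
qed

end

section \<open>Continuous operations in a bundle\<close>

context continuous_R_bundle
begin

lemma topspace_total: "topspace (arr_top (total B)) = arr (total B)"
  using topological_semigroupoid.topspace_arr[OF topological_total] .

lemma topspace_base: "topspace (arr_top (base B)) = arr (base B)"
  using topological_semigroupoid.topspace_arr[OF topological_base] .

lemma continuous_map_fadd:
  assumes "continuous_map Z (arr_top (total B)) f" "continuous_map Z (arr_top (total B)) g"
    and "\<And>z. z \<in> topspace Z \<Longrightarrow> proj B (f z) = proj B (g z)"
  shows "continuous_map Z (arr_top (total B)) (\<lambda>z. fadd B (f z) (g z))"
proof -
  have "f z \<in> arr (total B) \<and> g z \<in> arr (total B)" if "z \<in> topspace Z" for z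
    using that assms(1,2)[THEN continuous_map_funspace] topspace_total by blast
  then have "continuous_map Z (subtopology (prod_topology (arr_top (total B)) (arr_top (total B)))
            {(x, y). x \<in> arr (total B) \<and> y \<in> arr (total B) \<and> proj B x = proj B y}) (\<lambda>z. (f z, g z))"
    using assms by (auto simp: continuous_map_in_subtopology intro: continuous_map_pairedI)
  from continuous_map_compose[OF this continuous_fadd] show ?thesis by (simp add: o_def)
qed

lemma continuous_map_cmp:
  assumes "continuous_map Z (arr_top (total B)) f" "continuous_map Z (arr_top (total B)) g"
    and "\<And>z. z \<in> topspace Z \<Longrightarrow> (f z, g z) \<in> composable (total B)"
  shows "continuous_map Z (arr_top (total B)) (\<lambda>z. cmp (total B) (f z) (g z))"
proof -
  have "continuous_map Z (composable_top (total B)) (\<lambda>z. (f z, g z))"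
    using assms by (auto simp: continuous_map_in_subtopology intro: continuous_map_pairedI)
  from continuous_map_compose[OF this topological_semigroupoid.continuous_cmp[OF topological_total]]
  show ?thesis by (simp add: o_def)
qed

lemma continuous_map_flsc:
  assumes "continuous_map Z euclidean r" "continuous_map Z (arr_top (total B)) f"
  shows "continuous_map Z (arr_top (total B)) (\<lambda>z. flsc B (r z) (f z))"
  using continuous_map_compose[OF continuous_map_pairedI[OF assms] continuous_flsc] by (simp add: o_def)

lemma continuous_map_frsc:
  assumes "continuous_map Z (arr_top (total B)) f" "continuous_map Z euclidean r"
  shows "continuous_map Z (arr_top (total B)) (\<lambda>z. frsc B (f z) (r z))"
  using continuous_map_compose[OF continuous_map_pairedI[OF assms] continuous_frsc] by (simp add: o_def)

text \<open>
  The group in which the sum is formed varies with the point \<open>z\<close>.  Continuity therefore comes from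
  the bundle: from the zero section for the empty sum and from the fibrewise addition for each
  further term.
\<close>

lemma continuous_map_finprod_fibre:
  assumes "finite I" and \<pi>: "continuous_map Z (arr_top (base B)) \<pi>"
    and "\<And>i. i \<in> I \<Longrightarrow> continuous_map Z (arr_top (total B)) (f i)"
    and "\<And>i z. \<lbrakk>i \<in> I; z \<in> topspace Z\<rbrakk> \<Longrightarrow> f i z \<in> fibre B (\<pi> z)"
  shows "continuous_map Z (arr_top (total B)) (\<lambda>z. finprod (fibre_group B (\<pi> z)) (\<lambda>i. f i z) I)"
  using assms(1,3,4)
proof (induction I rule: finite_induct)
  case empty
  have "continuous_map Z (arr_top (total B)) (\<lambda>z. fzero B (\<pi> z))"
    using continuous_map_compose[OF \<pi> continuous_fzero] by (simp add: o_def)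
  then show ?case
  proof (rule continuous_map_eq)
    fix z assume "z \<in> topspace Z"
    then have "\<pi> z \<in> arr (base B)" using continuous_map_funspace[OF \<pi>] topspace_base by blast
    then interpret G: comm_monoid "fibre_group B (\<pi> z)" by (rule fibre_monoid)
    show "fzero B (\<pi> z) = finprod (fibre_group B (\<pi> z)) (\<lambda>i. f i z) {}" by simp
  qed
next
  case (insert i I)
  let ?S = "\<lambda>z. finprod (fibre_group B (\<pi> z)) (\<lambda>i. f i z) I"
  have S: "?S z \<in> fibre B (\<pi> z) \<and>
      finprod (fibre_group B (\<pi> z)) (\<lambda>i. f i z) (insert i I) = fadd B (f i z) (?S z)"
    if z: "z \<in> topspace Z" for z
  proof -
    have "\<pi> z \<in> arr (base B)" using z continuous_map_funspace[OF \<pi>] topspace_base by blast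
    then interpret G: comm_monoid "fibre_group B (\<pi> z)" by (rule fibre_monoid)
    have "(\<lambda>i. f i z) \<in> I \<rightarrow> carrier (fibre_group B (\<pi> z))" "f i z \<in> carrier (fibre_group B (\<pi> z))"
      using insert.prems(2) z by auto
    then show ?thesis
      using G.finprod_closed[of "\<lambda>i. f i z" I] insert.hyps by (simp add: G.finprod_insert)
  qed
  have "continuous_map Z (arr_top (total B)) (\<lambda>z. fadd B (f i z) (?S z))"
  proof (rule continuous_map_fadd)
    show "continuous_map Z (arr_top (total B)) ?S" using insert by blast
    show "proj B (f i z) = proj B (?S z)" if "z \<in> topspace Z" for z
      using S[OF that] insert.prems(2)[OF insertI1 that] by (simp add: fibre_def)
  qed (use insert.prems in blast)
  then show ?case by (rule continuous_map_eq) (use S in simp)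
qed

end

section \<open>The sectional algebra over a Hausdorff base with proper multiplication\<close>

locale proper_etale_bundle = continuous_R_bundle B + base: etale_semigroupoid "base B"
  for B :: "('r::{ring,topological_ab_group_add,topological_monoid_mult}, 'l, 'w, 'g, 'v) fibred_bimodules" +
  assumes Hausdorff_base: "Hausdorff_space (arr_top (base B))"
    and proper_cmp: "compact_proper_map (composable_top (base B)) (arr_top (base B))
          (\<lambda>(a, b). cmp (base B) a b)"
begin

lemma factorizations_eq_fibre:
  "factorizations (base B) \<gamma>
    = {p \<in> topspace (composable_top (base B)). (case p of (a, b) \<Rightarrow> cmp (base B) a b) = \<gamma>}"
  unfolding base.topspace_composable_top factorizations_def by auto

sublocale finitely_factorizing_bundle B
proof
  fix \<gamma> assume "\<gamma> \<in> arr (base B)"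
  then have "compactin (arr_top (base B)) {\<gamma>}" using topspace_base by simp
  then have "compactin (composable_top (base B))
      {p \<in> topspace (composable_top (base B)). (case p of (a, b) \<Rightarrow> cmp (base B) a b) \<in> {\<gamma>}}"
    using proper_cmp unfolding compact_proper_map_def by blast
  then show "finite (factorizations (base B) \<gamma>)"
    unfolding factorizations_eq_fibre singleton_iff
    by (rule finite_fibre_of_locally_injective[OF _ base.cmp_locally_injective])
qed

text \<open>
  A continuous map into a locally compact Hausdorff space is closed if preimages of compact sets are
  compact, since closed sets of the target are detected on its compact subsets.
\<close>

lemma closed_map_cmp:
  "closed_map (composable_top (base B)) (arr_top (base B)) (\<lambda>(a, b). cmp (base B) a b)"
proof -
  have "proper_map (composable_top (base B)) (arr_top (base B)) (\<lambda>(a, b). cmp (base B) a b)"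
  proof (rule compact_imp_proper_map)
    show "k_space (arr_top (base B))"
      by (rule locally_compact_imp_k_space[OF base.locally_compact_arr])
    show "kc_space (arr_top (base B))" by (rule Hausdorff_imp_kc_space[OF Hausdorff_base])
    show "compactin (composable_top (base B))
        {p \<in> topspace (composable_top (base B)). (case p of (a, b) \<Rightarrow> cmp (base B) a b) \<in> K}"
      if "compactin (arr_top (base B)) K" for K
      using proper_cmp that unfolding compact_proper_map_def by blast
  qed (use base.continuous_cmp continuous_map_funspace[OF base.continuous_cmp] in blast)+
  then show ?thesis by (simp add: proper_map_def)
qed

lemma factorizations_local_sections:
  assumes "\<gamma> \<in> arr (base B)"
  obtains W \<sigma> where "openin (arr_top (base B)) W" "\<gamma> \<in> W"
    and "\<And>p. p \<in> factorizations (base B) \<gamma> \<Longrightarrow>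
      continuous_map (subtopology (arr_top (base B)) W) (composable_top (base B)) (\<sigma> p)"
    and "\<And>\<delta>. \<delta> \<in> W \<Longrightarrow>
      bij_betw (\<lambda>p. \<sigma> p \<delta>) (factorizations (base B) \<gamma>) (factorizations (base B) \<delta>)"
proof -
  have H: "Hausdorff_space (composable_top (base B))"
    using Hausdorff_base by (simp add: Hausdorff_space_subtopology Hausdorff_space_prod_topology)
  have \<gamma>: "\<gamma> \<in> topspace (arr_top (base B))" using assms topspace_base by simp
  show thesis
    using finite_covering_local_sections[OF H base.continuous_cmp base.open_map_cmp closed_map_cmp
        base.cmp_locally_injective \<gamma> finite_factorizations[OF assms, unfolded factorizations_eq_fibre],
        folded factorizations_eq_fibre] that
    by blast
qed

text \<open>
  Over the domain \<open>W\<close> of the local sections \<open>\<sigma> p\<close> the convolution is the sum of the products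
  \<open>\<alpha>(a)\<beta>(b)\<close> with \<open>(a, b) = \<sigma> p \<delta>\<close>, and the index \<open>p\<close> runs through a set that is constant on \<open>W\<close>.
  The parameter \<open>z\<close> serves two purposes: a one-point space \<open>Z\<close> gives continuity of a single
  convolution, and pairs of sections as parameters give continuity of the product.
\<close>

lemma continuous_map_sec_conv:
  assumes sec: "\<And>z. z \<in> topspace Z \<Longrightarrow> \<alpha> z \<in> sections B" "\<And>z. z \<in> topspace Z \<Longrightarrow> \<beta> z \<in> sections B"
    and \<alpha>: "continuous_map (prod_topology Z (arr_top (base B))) (arr_top (total B)) (\<lambda>(z, \<gamma>). \<alpha> z \<gamma>)"
    and \<beta>: "continuous_map (prod_topology Z (arr_top (base B))) (arr_top (total B)) (\<lambda>(z, \<gamma>). \<beta> z \<gamma>)"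
  shows "continuous_map (prod_topology Z (arr_top (base B))) (arr_top (total B))
           (\<lambda>(z, \<gamma>). sec_conv B (\<alpha> z) (\<beta> z) \<gamma>)"
proof (rule continuous_map_locally)
  let ?\<Gamma> = "arr_top (base B)" and ?\<Lambda> = "arr_top (total B)" and ?ZG = "prod_topology Z (arr_top (base B))"
  fix q assume q: "q \<in> topspace ?ZG"
  let ?F = "factorizations (base B) (snd q)"
  have \<gamma>: "snd q \<in> arr (base B)" using q by (simp add: mem_Times_iff topspace_base)
  obtain W \<sigma> where W: "openin ?\<Gamma> W" "snd q \<in> W"
    and \<sigma>: "\<And>p. p \<in> ?F \<Longrightarrow> continuous_map (subtopology ?\<Gamma> W) (composable_top (base B)) (\<sigma> p)"
    and bij: "\<And>\<delta>. \<delta> \<in> W \<Longrightarrow> bij_betw (\<lambda>p. \<sigma> p \<delta>) ?F (factorizations (base B) \<delta>)"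
    using factorizations_local_sections[OF \<gamma>] by blast
  let ?U = "topspace Z \<times> W"
  let ?ZW = "subtopology ?ZG ?U"
  have in_ZW: "fst t \<in> topspace Z \<and> snd t \<in> W \<and> snd t \<in> arr (base B)" if "t \<in> topspace ?ZW" for t
    using that by (simp add: mem_Times_iff topspace_base)
  have fst: "continuous_map ?ZW Z fst" and snd: "continuous_map ?ZW ?\<Gamma> snd"
    by (simp_all add: continuous_map_from_subtopology continuous_map_fst continuous_map_snd)
  have snd_W: "continuous_map ?ZW (subtopology ?\<Gamma> W) snd"
    using snd by (auto simp: continuous_map_in_subtopology)
  have \<sigma>_in: "\<sigma> p (snd t) \<in> factorizations (base B) (snd t)" if "p \<in> ?F" "t \<in> topspace ?ZW" for p t
    using bij_betw_apply[OF bij] in_ZW[OF that(2)] that(1) by blast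
  have \<sigma>_cont: "continuous_map ?ZW ?\<Gamma> (\<lambda>t. fst (\<sigma> p (snd t)))"
    "continuous_map ?ZW ?\<Gamma> (\<lambda>t. snd (\<sigma> p (snd t)))" if p: "p \<in> ?F" for p
  proof -
    have "continuous_map ?ZW (prod_topology ?\<Gamma> ?\<Gamma>) (\<lambda>t. \<sigma> p (snd t))"
      using continuous_map_compose[OF snd_W \<sigma>[OF p]] by (simp add: continuous_map_in_subtopology o_def)
    then show "continuous_map ?ZW ?\<Gamma> (\<lambda>t. fst (\<sigma> p (snd t)))"
      "continuous_map ?ZW ?\<Gamma> (\<lambda>t. snd (\<sigma> p (snd t)))"
      by (simp_all add: continuous_map_pairwise o_def)
  qed
  have "continuous_map ?ZW ?\<Lambda> (\<lambda>t. finprod (fibre_group B (snd t))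
      (\<lambda>p. summand (\<alpha> (fst t)) (\<beta> (fst t)) (\<sigma> p (snd t))) ?F)"
  proof (rule continuous_map_finprod_fibre[OF finite_factorizations[OF \<gamma>] snd])
    fix p assume p: "p \<in> ?F"
    show "continuous_map ?ZW ?\<Lambda> (\<lambda>t. summand (\<alpha> (fst t)) (\<beta> (fst t)) (\<sigma> p (snd t)))"
    proof (rule continuous_map_cmp)
      show "continuous_map ?ZW ?\<Lambda> (\<lambda>t. \<alpha> (fst t) (fst (\<sigma> p (snd t))))"
        using continuous_map_compose[OF continuous_map_pairedI[OF fst \<sigma>_cont(1)[OF p]] \<alpha>]
        by (simp add: o_def)
      show "continuous_map ?ZW ?\<Lambda> (\<lambda>t. \<beta> (fst t) (snd (\<sigma> p (snd t))))"
        using continuous_map_compose[OF continuous_map_pairedI[OF fst \<sigma>_cont(2)[OF p]] \<beta>]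
        by (simp add: o_def)
      fix t assume t: "t \<in> topspace ?ZW"
      note f = factorizationsD[OF \<sigma>_in[OF p t]]
      show "(\<alpha> (fst t) (fst (\<sigma> p (snd t))), \<beta> (fst t) (snd (\<sigma> p (snd t)))) \<in> composable (total B)"
        using in_ZW[OF t] sec by (intro fibres_composable[OF f(1)] section_in_fibre f(3,4)) auto
    qed
    fix t assume t: "t \<in> topspace ?ZW"
    show "summand (\<alpha> (fst t)) (\<beta> (fst t)) (\<sigma> p (snd t)) \<in> fibre B (snd t)"
      using summand_in_fibre[OF sec(1) sec(2) \<sigma>_in[OF p t]] in_ZW[OF t] by blast
  qed
  then have "continuous_map ?ZW ?\<Lambda> (\<lambda>(z, \<gamma>). sec_conv B (\<alpha> z) (\<beta> z) \<gamma>)"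
  proof (rule continuous_map_eq)
    fix t assume t: "t \<in> topspace ?ZW"
    note z = in_ZW[OF t]
    interpret G: comm_monoid "fibre_group B (snd t)" using z fibre_monoid by blast
    let ?s = "summand (\<alpha> (fst t)) (\<beta> (fst t))"
    note b = bij[of "snd t"]
    have "finprod (fibre_group B (snd t)) (\<lambda>p. ?s (\<sigma> p (snd t))) ?F
        = finprod (fibre_group B (snd t)) ?s ((\<lambda>p. \<sigma> p (snd t)) ` ?F)"
      by (rule G.finprod_reindex[symmetric])
        (use z b summand_in_fibre[OF sec] in \<open>auto simp: bij_betw_def\<close>)
    also have "\<dots> = sec_conv B (\<alpha> (fst t)) (\<beta> (fst t)) (snd t)"
      using z b by (simp add: sec_conv_eq sec bij_betw_def)
    finally show "finprod (fibre_group B (snd t)) (\<lambda>p. ?s (\<sigma> p (snd t))) ?F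
        = (case t of (z, \<gamma>) \<Rightarrow> sec_conv B (\<alpha> z) (\<beta> z) \<gamma>)"
      by (simp add: case_prod_unfold)
  qed
  moreover have "openin ?ZG ?U" using W(1) by (simp add: openin_prod_Times_iff)
  moreover have "q \<in> ?U" using q W(2) by (simp add: mem_Times_iff)
  ultimately show "\<exists>U. openin ?ZG U \<and> q \<in> U \<and>
      continuous_map (subtopology ?ZG U) ?\<Lambda> (\<lambda>(z, \<gamma>). sec_conv B (\<alpha> z) (\<beta> z) \<gamma>)"
    by blast
qed

text \<open>
  A generator is continuous on \<open>V\<close>, and it is the zero section outside its support in \<open>V\<close>, a compact
  set.  In the Hausdorff space \<open>\<Gamma>\<close> this set is closed, so that the generator is continuous
  on two open sets covering \<open>\<Gamma>\<close>.  Conversely a compactly supported continuous section is a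
  generator for \<open>V = \<Gamma>\<close>.
\<close>

lemma sectional_algebra_iff:
  "\<alpha> \<in> sectional_algebra B \<longleftrightarrow>
     \<alpha> \<in> sections B \<and> continuous_map (arr_top (base B)) (arr_top (total B)) \<alpha> \<and>
     (\<exists>C. compactin (arr_top (base B)) C \<and> (\<forall>\<gamma>\<in>arr (base B) - C. \<alpha> \<gamma> = fzero B \<gamma>))"
    (is "_ \<longleftrightarrow> ?P \<alpha>")
proof
  let ?\<Gamma> = "arr_top (base B)" and ?\<Lambda> = "arr_top (total B)"
  note bim = fibre_bimodule
  assume "\<alpha> \<in> sectional_algebra B"
  then show "?P \<alpha>"
  proof induction
    case (Cc V \<alpha>)
    let ?C = "supp B \<alpha> \<inter> V"
    have sec: "\<alpha> \<in> sections B" and off: "\<And>\<gamma>. \<gamma> \<in> arr (base B) - V \<Longrightarrow> \<alpha> \<gamma> = fzero B \<gamma>"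
      and on: "continuous_map (subtopology ?\<Gamma> V) ?\<Lambda> \<alpha>" and C: "compactin ?\<Gamma> ?C"
      using Cc(3) by (auto simp: Cc_def)
    have zero: "\<alpha> \<gamma> = fzero B \<gamma>" if "\<gamma> \<in> arr (base B) - ?C" for \<gamma>
    proof (rule ccontr)
      assume nz: "\<alpha> \<gamma> \<noteq> fzero B \<gamma>"
      then have "\<gamma> \<in> V" using off that by blast
      moreover have "{\<gamma> \<in> arr (base B). \<alpha> \<gamma> \<noteq> fzero B \<gamma>} \<subseteq> supp B \<alpha>"
        unfolding supp_def by (rule closure_of_subset) (use topspace_base in blast)
      ultimately show False using nz that by blast
    qed
    have open_off: "openin ?\<Gamma> (topspace ?\<Gamma> - ?C)"
      using compactin_imp_closedin[OF Hausdorff_base C] by blast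
    have "continuous_map (subtopology ?\<Gamma> (topspace ?\<Gamma> - ?C)) ?\<Lambda> (fzero B)"
      by (rule continuous_map_from_subtopology[OF continuous_fzero])
    then have off_C: "continuous_map (subtopology ?\<Gamma> (topspace ?\<Gamma> - ?C)) ?\<Lambda> \<alpha>"
      by (rule continuous_map_eq) (use zero topspace_base in auto)
    have "continuous_map ?\<Gamma> ?\<Lambda> \<alpha>"
    proof (rule continuous_map_locally)
      fix \<gamma> assume \<gamma>: "\<gamma> \<in> topspace ?\<Gamma>"
      show "\<exists>U. openin ?\<Gamma> U \<and> \<gamma> \<in> U \<and> continuous_map (subtopology ?\<Gamma> U) ?\<Lambda> \<alpha>"
      proof (cases "\<gamma> \<in> V")
        case True
        then show ?thesis using Cc(1) on by blast
      next
        case False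
        then show ?thesis using \<gamma> open_off off_C by blast
      qed
    qed
    with sec C zero show ?case by blast
  next
    case zero
    have "continuous_map ?\<Gamma> ?\<Lambda> (sec_zero B)"
      by (rule continuous_map_eq[OF continuous_fzero]) (simp add: sec_zero_def topspace_base)
    moreover have "\<forall>\<gamma>\<in>arr (base B) - {}. sec_zero B \<gamma> = fzero B \<gamma>" by (simp add: sec_zero_def)
    ultimately show ?case using sec_zero_section compactin_empty by blast
  next
    case (add \<alpha> \<beta>)
    then obtain C D where CD: "compactin ?\<Gamma> C" "\<forall>\<gamma>\<in>arr (base B) - C. \<alpha> \<gamma> = fzero B \<gamma>"
      "compactin ?\<Gamma> D" "\<forall>\<gamma>\<in>arr (base B) - D. \<beta> \<gamma> = fzero B \<gamma>" by blast
    have fib: "\<alpha> \<gamma> \<in> fibre B \<gamma>" "\<beta> \<gamma> \<in> fibre B \<gamma>" if "\<gamma> \<in> arr (base B)" for \<gamma>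
      using add.IH section_in_fibre that by blast+
    have "continuous_map ?\<Gamma> ?\<Lambda> (\<lambda>\<gamma>. fadd B (\<alpha> \<gamma>) (\<beta> \<gamma>))"
      by (rule continuous_map_fadd) (use add.IH fib in \<open>auto simp: fibre_def topspace_base\<close>)
    then have "continuous_map ?\<Gamma> ?\<Lambda> (sec_add B \<alpha> \<beta>)"
      by (rule continuous_map_eq) (simp add: sec_add_def topspace_base)
    moreover have "\<forall>\<gamma>\<in>arr (base B) - (C \<union> D). sec_add B \<alpha> \<beta> \<gamma> = fzero B \<gamma>"
      using CD(2,4) bimodule_zero_and_inverse(1,4)[OF bim] by (simp add: sec_add_def)
    ultimately show ?case using sec_add_section add.IH compactin_Un[OF CD(1,3)] by blast
  next
    case (lsc \<alpha> r)
    then obtain C where C: "compactin ?\<Gamma> C" "\<forall>\<gamma>\<in>arr (base B) - C. \<alpha> \<gamma> = fzero B \<gamma>" by blast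
    have "continuous_map ?\<Gamma> ?\<Lambda> (\<lambda>\<gamma>. flsc B r (\<alpha> \<gamma>))"
      by (rule continuous_map_flsc) (use lsc.IH in auto)
    then have "continuous_map ?\<Gamma> ?\<Lambda> (sec_lsc B r \<alpha>)"
      by (rule continuous_map_eq) (simp add: sec_lsc_def topspace_base)
    moreover have "\<forall>\<gamma>\<in>arr (base B) - C. sec_lsc B r \<alpha> \<gamma> = fzero B \<gamma>"
      using C(2) bimodule_zero_and_inverse(2)[OF bim] by (simp add: sec_lsc_def)
    ultimately show ?case using sec_lsc_section lsc.IH C(1) by blast
  next
    case (rsc \<alpha> r)
    then obtain C where C: "compactin ?\<Gamma> C" "\<forall>\<gamma>\<in>arr (base B) - C. \<alpha> \<gamma> = fzero B \<gamma>" by blast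
    have "continuous_map ?\<Gamma> ?\<Lambda> (\<lambda>\<gamma>. frsc B (\<alpha> \<gamma>) r)"
      by (rule continuous_map_frsc) (use rsc.IH in auto)
    then have "continuous_map ?\<Gamma> ?\<Lambda> (sec_rsc B \<alpha> r)"
      by (rule continuous_map_eq) (simp add: sec_rsc_def topspace_base)
    moreover have "\<forall>\<gamma>\<in>arr (base B) - C. sec_rsc B \<alpha> r \<gamma> = fzero B \<gamma>"
      using C(2) bimodule_zero_and_inverse(3)[OF bim] by (simp add: sec_rsc_def)
    ultimately show ?case using sec_rsc_section rsc.IH C(1) by blast
  qed
next
  let ?\<Gamma> = "arr_top (base B)"
  assume P: "?P \<alpha>"
  then obtain C where C: "compactin ?\<Gamma> C" "\<forall>\<gamma>\<in>arr (base B) - C. \<alpha> \<gamma> = fzero B \<gamma>" by blast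
  have "supp B \<alpha> \<subseteq> C"
    unfolding supp_def
    by (rule closure_of_minimal[OF _ compactin_imp_closedin[OF Hausdorff_base C(1)]]) (use C(2) in blast)
  then have "compactin ?\<Gamma> (supp B \<alpha>)"
    using closed_compactin[OF C(1)] by (simp add: supp_def)
  then have "compactin ?\<Gamma> (supp B \<alpha> \<inter> topspace ?\<Gamma>)"
    using closure_of_subset_topspace[of ?\<Gamma>] by (simp add: supp_def Int_absorb2)
  then have "\<alpha> \<in> Cc B (topspace ?\<Gamma>)"
    using P continuous_map_from_subtopology by (auto simp: Cc_def topspace_base)
  then show "\<alpha> \<in> sectional_algebra B"
    using Hausdorff_base by (intro sectional_algebra.Cc[where V = "topspace ?\<Gamma>"]) simp_all
qed

text \<open>
  A nonzero value at \<open>\<gamma>\<close> requires a factorization \<open>\<gamma> = ab\<close> with \<open>a \<in> C\<close> and \<open>b \<in> D\<close>, where \<open>C\<close> and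
  \<open>D\<close> are compact sets outside which \<open>\<alpha>\<close> and \<open>\<beta>\<close> vanish.  These products form a compact set, because
  the composable pairs are closed in the product space and so meet \<open>C \<times> D\<close> in a compact set.
\<close>

lemma sec_conv_in_sectional_algebra:
  assumes "\<alpha> \<in> sectional_algebra B" "\<beta> \<in> sectional_algebra B"
  shows "sec_conv B \<alpha> \<beta> \<in> sectional_algebra B"
proof -
  let ?\<Gamma> = "arr_top (base B)" and ?\<Lambda> = "arr_top (total B)"
  obtain C D where s: "\<alpha> \<in> sections B" "\<beta> \<in> sections B"
    and cont: "continuous_map ?\<Gamma> ?\<Lambda> \<alpha>" "continuous_map ?\<Gamma> ?\<Lambda> \<beta>"
    and C: "compactin ?\<Gamma> C" "\<And>\<gamma>. \<gamma> \<in> arr (base B) - C \<Longrightarrow> \<alpha> \<gamma> = fzero B \<gamma>"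
    and D: "compactin ?\<Gamma> D" "\<And>\<gamma>. \<gamma> \<in> arr (base B) - D \<Longrightarrow> \<beta> \<gamma> = fzero B \<gamma>"
    using assms unfolding sectional_algebra_iff by blast
  \<comment> \<open>a one-point parameter space\<close>
  let ?P = "discrete_topology {()}"
  have "continuous_map (prod_topology ?P ?\<Gamma>) ?\<Lambda> (\<lambda>(z, \<gamma>). sec_conv B \<alpha> \<beta> \<gamma>)"
    by (rule continuous_map_sec_conv)
      (use s continuous_map_compose[OF continuous_map_snd cont(1)]
        continuous_map_compose[OF continuous_map_snd cont(2)] in \<open>simp_all add: o_def case_prod_unfold\<close>)
  from continuous_map_compose[OF continuous_map_pairedI this, of ?\<Gamma> "\<lambda>_. ()" "\<lambda>\<gamma>. \<gamma>"]
  have conv_cont: "continuous_map ?\<Gamma> ?\<Lambda> (sec_conv B \<alpha> \<beta>)" by (simp add: o_def)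
  let ?E = "(\<lambda>(a, b). cmp (base B) a b) ` ((C \<times> D) \<inter> composable (base B))"
  have "compactin (prod_topology ?\<Gamma> ?\<Gamma>) (C \<times> D)"
    using C(1) D(1) by (simp add: compactin_Times)
  then have "compactin (prod_topology ?\<Gamma> ?\<Gamma>) ((C \<times> D) \<inter> composable (base B))"
    by (rule compact_Int_closedin[OF _ base.closedin_composable])
  then have "compactin (composable_top (base B)) ((C \<times> D) \<inter> composable (base B))"
    by (simp add: compactin_subtopology)
  then have E: "compactin ?\<Gamma> ?E"
    by (rule image_compactin[OF _ base.continuous_cmp])
  have "sec_conv B \<alpha> \<beta> \<gamma> = fzero B \<gamma>" if \<gamma>: "\<gamma> \<in> arr (base B) - ?E" for \<gamma>
  proof -
    have \<gamma>': "\<gamma> \<in> arr (base B)" using \<gamma> by blast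
    interpret G: comm_monoid "fibre_group B \<gamma>" by (rule fibre_monoid[OF \<gamma>'])
    have "summand \<alpha> \<beta> p = fzero B \<gamma>" if p: "p \<in> factorizations (base B) \<gamma>" for p
    proof -
      note f = factorizationsD[OF p]
      have "p \<notin> C \<times> D"
        using \<gamma> p by (auto simp: factorizations_def)
      then consider "fst p \<notin> C" | "snd p \<notin> D" by (cases p) auto
      then show ?thesis
      proof cases
        case 1
        then show ?thesis
          using C(2) f cmp_zero(1)[OF f(1) section_in_fibre[OF s(2) f(4)]] by simp
      next
        case 2
        then show ?thesis
          using D(2) f cmp_zero(2)[OF f(1) section_in_fibre[OF s(1) f(3)]] by simp
      qed
    qed
    then show ?thesis
      unfolding sec_conv_eq[OF s \<gamma>'] using G.finprod_one_eqI[of _ "summand \<alpha> \<beta>"] by simp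
  qed
  then show ?thesis
    unfolding sectional_algebra_iff using sec_conv_section[OF s] conv_cont E by blast
qed

section \<open>The topological algebra\<close>

abbreviation sectional_top :: "('g \<Rightarrow> 'l) topology" where
  "sectional_top \<equiv> compact_open_topology (arr_top (base B)) (arr_top (total B)) (sectional_algebra B)"

lemma continuous_map_eval:
  assumes "continuous_map Z sectional_top f" "continuous_map Z (arr_top (base B)) g"
  shows "continuous_map Z (arr_top (total B)) (\<lambda>z. f z (g z))"
proof -
  have "neighbourhood_base_of (compactin (arr_top (base B))) (arr_top (base B))"
    using base.locally_compact_arr Hausdorff_base locally_compact_space_neighbourhood_base by blast
  then have "continuous_map (prod_topology sectional_top (arr_top (base B))) (arr_top (total B)) (\<lambda>(f, x). f x)"
    by (rule continuous_map_compact_open_eval) (use sectional_algebra_iff in blast)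
  from continuous_map_compose[OF continuous_map_pairedI[OF assms] this]
  show ?thesis by (simp add: o_def)
qed

text \<open>
  Each operation is uncurried to a map on a product with \<open>\<Gamma>\<close>, whose joint continuity follows from
  that of evaluation and of the operations of the bundle.
\<close>

theorem topological_algebra_sectional:
  "topological_algebra (sectional_algebra B)
     (sec_add B) (sec_zero B) (sec_lsc B) (sec_rsc B) (sec_conv B) sectional_top"
proof -
  let ?\<Gamma> = "arr_top (base B)" and ?\<Lambda> = "arr_top (total B)" and ?T = sectional_top
  have sec: "\<alpha> \<in> sections B" if "\<alpha> \<in> sectional_algebra B" for \<alpha>
    using that sectional_algebra_iff by blast
  interpret bimodule_algebra "sectional_algebra B" "sec_add B" "sec_zero B" "sec_lsc B" "sec_rsc B" "sec_conv B"
    by (rule bimodule_algebra_of_sections)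
      (rule subsetI sec sectional_algebra.zero sectional_algebra.add sectional_algebra.lsc
        sectional_algebra.rsc sec_conv_in_sectional_algebra; assumption?)+
  have in_arr: "snd t \<in> arr (base B)" if "t \<in> topspace (prod_topology Z ?\<Gamma>)" for t :: "'z \<times> 'g" and Z
    using that by (simp add: mem_Times_iff topspace_base)
  have fst1: "continuous_map (prod_topology (prod_topology X Y) ?\<Gamma>) X (\<lambda>t. fst (fst t))"
    and snd1: "continuous_map (prod_topology (prod_topology X Y) ?\<Gamma>) Y (\<lambda>t. snd (fst t))"
    for X :: "'x topology" and Y :: "'y topology"
    using continuous_map_compose[OF continuous_map_fst continuous_map_fst]
      continuous_map_compose[OF continuous_map_fst continuous_map_snd] by (force simp: o_def)+
  note fst_eval = continuous_map_eval[OF fst1 continuous_map_snd]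
    and snd_eval = continuous_map_eval[OF snd1 continuous_map_snd]
  show ?thesis
  proof
    show "topspace ?T = sectional_algebra B" by simp
    show "continuous_map (prod_topology ?T ?T) ?T (\<lambda>(\<alpha>, \<beta>). sec_add B \<alpha> \<beta>)"
    proof (rule continuous_map_into_compact_open)
      have "continuous_map (prod_topology (prod_topology ?T ?T) ?\<Gamma>) ?\<Lambda>
          (\<lambda>t. fadd B (fst (fst t) (snd t)) (snd (fst t) (snd t)))"
      proof (rule continuous_map_fadd[OF fst_eval snd_eval])
        fix t assume t: "t \<in> topspace (prod_topology (prod_topology ?T ?T) ?\<Gamma>)"
        then show "proj B (fst (fst t) (snd t)) = proj B (snd (fst t) (snd t))"
          using section_in_fibre[OF sec in_arr[OF t]] by (simp add: mem_Times_iff fibre_def)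
      qed
      then show "continuous_map (prod_topology (prod_topology ?T ?T) ?\<Gamma>) ?\<Lambda>
          (\<lambda>(z, \<gamma>). (case z of (\<alpha>, \<beta>) \<Rightarrow> sec_add B \<alpha> \<beta>) \<gamma>)"
        by (rule continuous_map_eq) (drule in_arr, simp add: sec_add_def case_prod_unfold)
    qed (auto intro: sectional_algebra.add)
    show "continuous_map (prod_topology ?T ?T) ?T (\<lambda>(\<alpha>, \<beta>). sec_conv B \<alpha> \<beta>)"
    proof (rule continuous_map_into_compact_open)
      have "continuous_map (prod_topology (prod_topology ?T ?T) ?\<Gamma>) ?\<Lambda>
          (\<lambda>(z, \<gamma>). sec_conv B (fst z) (snd z) \<gamma>)"
        by (rule continuous_map_sec_conv)
          (use sec fst_eval snd_eval in \<open>simp_all add: mem_Times_iff case_prod_unfold\<close>)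
      then show "continuous_map (prod_topology (prod_topology ?T ?T) ?\<Gamma>) ?\<Lambda>
          (\<lambda>(z, \<gamma>). (case z of (\<alpha>, \<beta>) \<Rightarrow> sec_conv B \<alpha> \<beta>) \<gamma>)"
        by (simp add: case_prod_unfold)
    qed (auto intro: sec_conv_in_sectional_algebra)
    show "continuous_map (prod_topology euclidean ?T) ?T (\<lambda>(r, \<alpha>). sec_lsc B r \<alpha>)"
    proof (rule continuous_map_into_compact_open)
      have "continuous_map (prod_topology (prod_topology euclidean ?T) ?\<Gamma>) ?\<Lambda>
          (\<lambda>t. flsc B (fst (fst t)) (snd (fst t) (snd t)))"
        by (rule continuous_map_flsc[OF fst1 snd_eval])
      then show "continuous_map (prod_topology (prod_topology euclidean ?T) ?\<Gamma>) ?\<Lambda>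
          (\<lambda>(z, \<gamma>). (case z of (r, \<alpha>) \<Rightarrow> sec_lsc B r \<alpha>) \<gamma>)"
        by (rule continuous_map_eq) (drule in_arr, simp add: sec_lsc_def case_prod_unfold)
    qed (auto intro: sectional_algebra.lsc)
    show "continuous_map (prod_topology ?T euclidean) ?T (\<lambda>(\<alpha>, r). sec_rsc B \<alpha> r)"
    proof (rule continuous_map_into_compact_open)
      have "continuous_map (prod_topology (prod_topology ?T euclidean) ?\<Gamma>) ?\<Lambda>
          (\<lambda>t. frsc B (fst (fst t) (snd t)) (snd (fst t)))"
        by (rule continuous_map_frsc[OF fst_eval snd1])
      then show "continuous_map (prod_topology (prod_topology ?T euclidean) ?\<Gamma>) ?\<Lambda>
          (\<lambda>(z, \<gamma>). (case z of (\<alpha>, r) \<Rightarrow> sec_rsc B \<alpha> r) \<gamma>)"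
        by (rule continuous_map_eq) (drule in_arr, simp add: sec_rsc_def case_prod_unfold)
    qed (auto intro: sectional_algebra.rsc)
  qed
qed

end

theorem proposition4p4:
  fixes B :: "('r::{ring,topological_ab_group_add,topological_monoid_mult}, 'l, 'w, 'g, 'v) fibred_bimodules"
  assumes "continuous_R_bundle B"
    and "etale_semigroupoid (base B)"
    and "Hausdorff_space (arr_top (base B))"
    and "locally_R_normal_space TYPE('r) (arr_top (base B))"
    and "compact_proper_map (composable_top (base B)) (arr_top (base B)) (\<lambda>(a, b). cmp (base B) a b)"
  shows "topological_algebra (sectional_algebra B)
           (sec_add B) (sec_zero B) (sec_lsc B) (sec_rsc B) (sec_conv B)
           (compact_open_topology (arr_top (base B)) (arr_top (total B)) (sectional_algebra B))"
proof -
  interpret continuous_R_bundle B by fact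
  interpret base: etale_semigroupoid "base B" by fact
  interpret proper_etale_bundle B by unfold_locales fact+
  show ?thesis by (rule topological_algebra_sectional)
qed

end
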